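(* Let $p\ge 1$ and $m\in\mathbb{Z}_{\ge0}$. Let $\mathbf{c}=(c_1,\dots,c_{p+1})\in(\mathbb{C}\setminus\mathbb{Z})^{p+1}$ and $\mathbf{d}=(d_1,\dots,d_{p-1})\in(\mathbb{C}\setminus\mathbb{Z})^{p-1}$, with $d_j-d_k\notin\mathbb{Z}$ for $j\ne k$, and suppose $\Re\big(\sum_{j=1}^{p-1}d_j-\sum_{j=1}^{p+1}c_j\big)>-m-1$. Then \begin{multline*} \sum_{k=0}^{\infty}\frac{(\mathbf{c})_{k}}{(\mathbf{d})_{k}(m+k)!\,k!}\Big\{\sum_{d\in\mathbf{d}}\psi(d+k)+\psi(k+1)+\psi(1+m+k)-\sum_{c\in\mathbf{c}}\psi(c+k)\Big\}\\ =\frac{\pi}{m!}\Big\{\sum_{c\in\mathbf{c}}\cot(\pi c)-\sum_{d\in\mathbf{d}}\cot(\pi d)\Big\}\,{}_{p+1}F_{p}\!\left(\begin{matrix}\mathbf{c}\\1+m,\mathbf{d}\end{matrix}\right) +\frac{(1-\mathbf{d})_{1}}{(1-\mathbf{c})_{1}(m-1)!}\,{}_{p+2}F_{p+1}\!\left(\begin{matrix}1-m,2-\mathbf{d},1,1\\2-\mathbf{c}\end{matrix}\right)\\ -\frac{\Gamma(1-\mathbf{c})}{\Gamma(1-\mathbf{d})}\sum_{k=1}^{p-1}\frac{(-1)^m\Gamma(d_k-m)\Gamma(d_k)\Gamma(d_k-\mathbf{d}_{[k]})}{(d_k-m-1)(d_k-1)\Gamma(d_k-\mathbf{c})}\,{}_{p+1}F_{p}\!\left(\begin{matrix}1+\mathbf{c}-d_k\\2-d_k,\,2-d_k+m,\,1+\mathbf{d}_{[k]}-d_k\end{matrix}\right).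 \end{multline*}
   Context: $\psi=\Gamma'/\Gamma$ is the digamma function and $(x)_k=\Gamma(x+k)/\Gamma(x)$ the Pochhammer symbol. For a vector $\mathbf{a}=(a_1,\dots,a_q)$ and scalar $\beta$: $\Gamma(\mathbf{a})=\prod_i\Gamma(a_i)$, $(\mathbf{a})_k=\prod_i(a_i)_k$, $\mathbf{a}+\beta=(a_1+\beta,\dots,a_q+\beta)$, $\beta-\mathbf{a}=(\beta-a_1,\dots,\beta-a_q)$, $\mathbf{a}_{[k]}$ is $\mathbf{a}$ with the $k$-th component removed, and $\sum_{a\in\mathbf{a}}$ runs over the components of $\mathbf{a}$ (with multiplicity). ${}_pF_q(\mathbf{a};\mathbf{b};z)=\sum_{k\ge0}\frac{(\mathbf{a})_k}{(\mathbf{b})_k}\frac{z^k}{k!}$ is the generalized hypergeometric function; when the argument is omitted it is $z=1$. Listing several vectors/scalars separated by commas in a parameter row means concatenation. The term $\frac{1}{(m-1)!}{}_{p+2}F_{p+1}(1-m,2-\mathbf{d},1,1;2-\mathbf{c};1)$ is understood as the finite sum $\sum_{j=0}^{m-1}\frac{(-1)^j(2-\mathbf{d})_j\, j!}{(2-\mathbf{c})_j\,(m-1-j)!}$, which is $0$ for $m=0$. *)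

theory Defs
  imports "HOL-Analysis.Analysis"
begin

definition poch_vec :: "complex list \<Rightarrow> nat \<Rightarrow> complex" where
  "poch_vec as k = prod_list (map (\<lambda>a. pochhammer a k) as)"

definition Gamma_vec :: "complex list \<Rightarrow> complex" where
  "Gamma_vec as = prod_list (map Gamma as)"

definition hypergeom :: "complex list \<Rightarrow> complex list \<Rightarrow> complex \<Rightarrow> complex" where
  "hypergeom as bs z = (\<Sum>k. poch_vec as k / poch_vec bs k * z ^ k / fact k)"

definition remove_nth :: "nat \<Rightarrow> 'a list \<Rightarrow> 'a list" where
  "remove_nth k xs = take k xs @ drop (Suc k) xs"

end

theory Submission
  imports Defs "HOL-Complex_Analysis.Residue_Theorem" "HOL-Real_Asymp.Real_Asymp"
begin

text \<open>
  The identity says that the residues of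
  \<open>\<Gamma>(-s) \<Gamma>(-m-s) \<Gamma>(1-d-s) / \<Gamma>(1-c-s)\<close> sum to zero: the double poles at the integers \<open>k \<ge> 0\<close> give
  the digamma series and the cotangent term, the simple poles at \<open>-1, \<dots>, -m\<close> the finite sum, and the
  simple poles at \<open>1 - d\<^sub>j + n\<close> the remaining hypergeometric series.

  To avoid estimating Gamma functions on large contours, every Gamma function is replaced by a finite
  Pochhammer product of length \<open>M\<close>. An extra factor \<open>(M + 1 - s) ^ (m + 1)\<close> makes the resulting rational
  function behave like \<open>-1/s\<close> at infinity, so its residues sum to \<open>-1\<close>. Every residue at the \<open>k\<close>-th point of a
  progression is the \<open>k\<close>-th term of the limiting series times a weight in \<open>M - k\<close> growing like
  \<open>(M - k) powr \<alpha>\<close>, where \<open>\<alpha> = m + 1 + \<Sum>d - \<Sum>c\<close>. Since \<open>Re \<alpha> > 0\<close>, dividing by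
  \<open>M powr \<alpha>\<close> and letting \<open>M \<rightarrow> \<infinity>\<close> is justified by dominated convergence.
\<close>

subsection \<open>Residues of rational functions and logarithmic derivatives\<close>

text \<open>On a large circle of radius \<open>R\<close> the function is within \<open>e / R\<close>
  of \<open>L / s\<close>, whose contour integral is \<open>2 * pi * \<i> * L\<close>. The length
  \<open>2 * pi * R\<close> of the circle cancels the \<open>R\<close>, leaving an error
  proportional to the arbitrary \<open>e\<close>.\<close>

lemma sum_residues_eq_limit:
  fixes f :: "complex \<Rightarrow> complex"
  assumes fin: "finite P" and holo: "f holomorphic_on -P"
    and lim: "((\<lambda>s. s * f s) \<longlongrightarrow> L) at_infinity"
  shows "(\<Sum>p\<in>P. residue f p) = L"
proof -
  define S where "S = (\<Sum>p\<in>P. residue f p)"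
  have "norm (S - L) \<le> e" if e: "e > 0" for e
  proof -
    from lim e obtain b where b: "\<And>s. norm s \<ge> b \<Longrightarrow> norm (s * f s - L) < e"
      unfolding tendsto_iff eventually_at_infinity dist_norm by blast
    \<comment> \<open>The sum of the norms puts every point of \<open>P\<close> strictly inside the
      circle, so all winding numbers are 1.\<close>
    define R where "R = 1 + \<bar>b\<bar> + (\<Sum>p\<in>P. norm p)"
    have R0: "R > 0" and Rb: "R \<ge> b"
      unfolding R_def using sum_nonneg[of P norm] by (auto intro: add_pos_nonneg)
    have RP: "norm p < R" if "p \<in> P" for p
    proof -
      have "norm p \<le> (\<Sum>p\<in>P. norm p)" by (rule member_le_sum) (use that fin in auto)
      then show ?thesis unfolding R_def by linarith
    qed
    have img: "path_image (circlepath 0 R) \<subseteq> -P"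
      using RP R0 by fastforce
    have "contour_integral (circlepath 0 R) f =
        2 * pi * \<i> * (\<Sum>p\<in>P. winding_number (circlepath 0 R) p * residue f p)"
      by (rule Residue_theorem[of UNIV]) (use fin holo img in \<open>auto simp: Compl_eq_Diff_UNIV\<close>)
    also have "(\<Sum>p\<in>P. winding_number (circlepath 0 R) p * residue f p) = S"
      unfolding S_def by (rule sum.cong) (use RP in \<open>auto simp: winding_number_circlepath\<close>)
    finally have I: "contour_integral (circlepath 0 R) f = 2 * pi * \<i> * S" .
    have "f contour_integrable_on circlepath 0 R"
      by (rule contour_integrable_continuous_circlepath)
        (use holo img holomorphic_on_imp_continuous_on continuous_on_subset in blast)
    then have c1: "(f has_contour_integral 2 * pi * \<i> * S) (circlepath 0 R)"
      using I has_contour_integral_integral by metis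
    have "((\<lambda>w. L / (w - 0)) has_contour_integral (2 * of_real pi * \<i> * L)) (circlepath 0 R)"
      by (rule Cauchy_integral_circlepath_simple[where f = "\<lambda>_. L"]) (use R0 in auto)
    then have c2: "((\<lambda>w. f w - L / (w - 0)) has_contour_integral
        (2 * pi * \<i> * S - 2 * of_real pi * \<i> * L)) (circlepath 0 R)"
      by (intro has_contour_integral_diff c1)
    have "norm (2 * pi * \<i> * S - 2 * of_real pi * \<i> * L) \<le> e / R * (2 * pi * R)"
    proof (rule has_contour_integral_bound_circlepath[OF c2])
      show "0 \<le> e / R" "0 < R" using e R0 by auto
      fix x :: complex assume x: "norm (x - 0) = R"
      then have x0: "x \<noteq> 0" using R0 by auto
      have "f x - L / (x - 0) = (x * f x - L) / x" using x0 by (simp add: field_simps)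
      also have "norm \<dots> \<le> e / R"
        using b[of x] x Rb R0 by (simp add: norm_divide divide_right_mono)
      finally show "norm (f x - L / (x - 0)) \<le> e / R" .
    qed
    also have "2 * pi * \<i> * S - 2 * of_real pi * \<i> * L = 2 * pi * \<i> * (S - L)"
      by (simp add: algebra_simps)
    finally show ?thesis using R0 by (simp add: norm_mult)
  qed
  then have "norm (S - L) \<le> 0" by (rule field_le_epsilon) simp
  then show ?thesis by (simp add: S_def)
qed

text \<open>With \<open>num\<close> and \<open>den\<close> entire, the set where \<open>den\<close>
  is nonzero is an open neighbourhood of \<open>z\<close>, so the only pole to consider there is the
  explicit factor \<open>s - z\<close>.\<close>

lemma residue_simple_quotient:
  assumes "num holomorphic_on UNIV" "den holomorphic_on UNIV" "den z \<noteq> 0"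
  shows "residue (\<lambda>s. num s / (den s * (s - z))) z = num z / den z"
proof -
  have "open (den -` (-{0}))"
    using assms(2) by (intro open_vimage holomorphic_on_imp_continuous_on) auto
  moreover have "(\<lambda>s. num s / den s) holomorphic_on den -` (-{0})"
    by (intro holomorphic_intros holomorphic_on_subset[OF assms(1)] holomorphic_on_subset[OF assms(2)]) auto
  ultimately have "residue (\<lambda>s. num s / den s / (s - z)) z = num z / den z"
    using assms(3) by (intro residue_simple[of "den -` (-{0})"]) auto
  then show ?thesis by (simp add: field_simps)
qed

lemma residue_double_quotient:
  assumes "num holomorphic_on UNIV" "den holomorphic_on UNIV" "den z \<noteq> 0"
    and "((\<lambda>s. num s / den s) has_field_derivative D) (at z)"
  shows "residue (\<lambda>s. num s / (den s * (s - z)^2)) z = D"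
proof -
  have "open (den -` (-{0}))"
    using assms(2) by (intro open_vimage holomorphic_on_imp_continuous_on) auto
  moreover have "(\<lambda>s. num s / den s) holomorphic_on den -` (-{0})"
    by (intro holomorphic_intros holomorphic_on_subset[OF assms(1)] holomorphic_on_subset[OF assms(2)]) auto
  ultimately have "residue (\<lambda>s. num s / den s / (s - z)^Suc 1) z = (deriv ^^ 1) (\<lambda>s. num s / den s) z / fact 1"
    using assms(3) by (intro residue_holomorphic_over_power[of "den -` (-{0})"]) auto
  then show ?thesis using DERIV_imp_deriv[OF assms(4)] by (simp add: field_simps power2_eq_square)
qed

text \<open>Writing the derivative as \<open>f z * l\<close> turns products into sums of the
  \<open>l\<close>. The residue at a double pole then becomes a value times one sum over all
  factors, and the condition \<open>f z \<noteq> 0\<close> also supplies the nonvanishing of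
  denominators.\<close>

definition has_logderiv :: "(complex \<Rightarrow> complex) \<Rightarrow> complex \<Rightarrow> complex \<Rightarrow> bool" where
  "has_logderiv f l z \<longleftrightarrow> f z \<noteq> 0 \<and> (f has_field_derivative f z * l) (at z)"

lemma has_logderiv_mult:
  "has_logderiv f l z \<Longrightarrow> has_logderiv g l' z \<Longrightarrow> has_logderiv (\<lambda>s. f s * g s) (l + l') z"
  unfolding has_logderiv_def by (auto intro!: derivative_eq_intros simp: algebra_simps)

lemma has_logderiv_divide:
  "has_logderiv f l z \<Longrightarrow> has_logderiv g l' z \<Longrightarrow> has_logderiv (\<lambda>s. f s / g s) (l - l') z"
  unfolding has_logderiv_def by (auto intro!: derivative_eq_intros simp: field_simps)

lemma has_logderiv_const: "a \<noteq> 0 \<Longrightarrow> has_logderiv (\<lambda>_. a) 0 z"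
  unfolding has_logderiv_def by auto

lemma has_logderiv_linear: "a \<noteq> z \<Longrightarrow> has_logderiv (\<lambda>s. a - s) (- 1 / (a - z)) z"
  unfolding has_logderiv_def by (auto intro!: derivative_eq_intros)

lemma has_logderiv_power:
  "has_logderiv f l z \<Longrightarrow> has_logderiv (\<lambda>s. f s ^ n) (of_nat n * l) z"
  by (induction n) (auto simp: algebra_simps intro: has_logderiv_const has_logderiv_mult)

lemma has_logderiv_prod_list:
  "(\<And>x. x \<in> set xs \<Longrightarrow> has_logderiv (f x) (l x) z) \<Longrightarrow>
    has_logderiv (\<lambda>s. prod_list (map (\<lambda>x. f x s) xs)) (sum_list (map l xs)) z"
  by (induction xs) (auto intro: has_logderiv_const has_logderiv_mult)

lemma has_logderiv_pochhammer:
  assumes "\<And>i. i < n \<Longrightarrow> a - z + of_nat i \<noteq> 0"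
  shows "has_logderiv (\<lambda>s. pochhammer (a - s) n) (- (\<Sum>i<n. 1 / (a - z + of_nat i))) z"
  using assms
proof (induction n)
  case 0
  then show ?case using has_logderiv_const[of 1] by simp
next
  case (Suc n)
  have "has_logderiv (\<lambda>s. pochhammer (a - s) n * ((a + of_nat n) - s))
     (- (\<Sum>i<n. 1 / (a - z + of_nat i)) + (- 1 / (a + of_nat n - z))) z"
    using Suc.prems[of n]
    by (intro has_logderiv_mult Suc.IH has_logderiv_linear Suc.prems) (auto simp: algebra_simps)
  then show ?case by (simp add: pochhammer_Suc algebra_simps)
qed

section \<open>Holomorphy and behaviour at infinity of Pochhammer products\<close>

lemma holomorphic_on_prod_list:
  "(\<And>x. x \<in> set xs \<Longrightarrow> f x holomorphic_on A) \<Longrightarrow>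
    (\<lambda>s. prod_list (map (\<lambda>x. f x s) xs)) holomorphic_on A"
  by (induction xs) (auto intro!: holomorphic_intros)

lemma holomorphic_on_pochhammer_diff: "(\<lambda>s. pochhammer (a - s) n) holomorphic_on A"
  by (induction n) (auto simp: pochhammer_Suc intro!: holomorphic_intros)

text \<open>Each of the \<open>n\<close> factors \<open>(a + i - s) / s\<close> tends to
  \<open>-1\<close>.\<close>

lemma tendsto_pochhammer_diff_over_power:
  "((\<lambda>s::complex. pochhammer (a - s) n / s ^ n) \<longlongrightarrow> (-1) ^ n) at_infinity"
proof (induction n)
  case (Suc n)
  have "((\<lambda>s::complex. (a + of_nat n) / s - 1) \<longlongrightarrow> 0 - 1) at_infinity"
    by (intro tendsto_intros tendsto_divide_0[OF tendsto_const] filterlim_ident)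
  moreover have "eventually (\<lambda>s::complex. (a + of_nat n) / s - 1 = (a - s + of_nat n) / s) at_infinity"
    using eventually_not_equal_at_infinity[of 0] by eventually_elim (simp add: field_simps)
  ultimately have lin: "((\<lambda>s::complex. (a - s + of_nat n) / s) \<longlongrightarrow> - 1) at_infinity"
    by (simp add: Lim_transform_eventually)
  show ?case
    using tendsto_mult[OF Suc lin]
    by (simp add: pochhammer_Suc mult.commute)
qed auto

lemma tendsto_prod_list:
  fixes f :: "'a \<Rightarrow> 'b \<Rightarrow> complex"
  shows "(\<And>x. x \<in> set xs \<Longrightarrow> (f x \<longlongrightarrow> l x) F) \<Longrightarrow>
    ((\<lambda>s. prod_list (map (\<lambda>x. f x s) xs)) \<longlongrightarrow> prod_list (map l xs)) F"
  by (induction xs) (auto intro!: tendsto_intros)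

subsection \<open>Power growth of Pochhammer quotients\<close>

text \<open>The base is \<open>Suc n\<close> because \<open>0 powr \<alpha> = 0\<close> would make the quotient at \<open>n = 0\<close> junk.\<close>
definition has_growth :: "(nat \<Rightarrow> complex) \<Rightarrow> complex \<Rightarrow> complex \<Rightarrow> bool" where
  "has_growth f \<alpha> L \<longleftrightarrow> (\<lambda>n. f n / of_nat (Suc n) powr \<alpha>) \<longlonglongrightarrow> L"

lemma has_growth_mult:
  assumes "has_growth f \<alpha> L" "has_growth g \<beta> K"
  shows "has_growth (\<lambda>n. f n * g n) (\<alpha> + \<beta>) (L * K)"
  using tendsto_mult[OF assms[unfolded has_growth_def]]
  by (simp add: has_growth_def powr_add times_divide_times_eq del: of_nat_Suc)

lemma has_growth_divide:
  assumes "has_growth f \<alpha> L" "has_growth g \<beta> K" "K \<noteq> 0"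
  shows "has_growth (\<lambda>n. f n / g n) (\<alpha> - \<beta>) (L / K)"
  using tendsto_divide[OF assms[unfolded has_growth_def]]
  by (simp add: has_growth_def powr_diff divide_divide_times_eq mult.commute del: of_nat_Suc)

lemma has_growth_const: "has_growth (\<lambda>_. a) 0 a"
  by (simp add: has_growth_def del: of_nat_Suc)

lemma has_growth_power:
  assumes "has_growth f \<alpha> L" shows "has_growth (\<lambda>n. f n ^ k) (of_nat k * \<alpha>) (L ^ k)"
proof (induction k)
  case (Suc k)
  then show ?case using has_growth_mult[OF assms Suc] by (simp add: algebra_simps)
qed (auto intro: has_growth_const)

lemma has_growth_prod_list:
  "(\<And>x. x \<in> set xs \<Longrightarrow> has_growth (f x) (\<alpha> x) (L x)) \<Longrightarrow>
    has_growth (\<lambda>n. prod_list (map (\<lambda>x. f x n) xs)) (sum_list (map \<alpha> xs)) (prod_list (map L xs))"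
  by (induction xs) (auto intro: has_growth_const has_growth_mult)

lemma has_growth_tendsto_0: "has_growth f 0 L \<longleftrightarrow> f \<longlonglongrightarrow> L"
  by (simp add: has_growth_def del: of_nat_Suc)

lemma has_growth_linear: "has_growth (\<lambda>n. of_nat n + a) 1 1"
proof -
  have "(\<lambda>n. inverse (of_nat (Suc n)) :: complex) \<longlonglongrightarrow> 0"
    by (rule LIMSEQ_Suc[OF lim_inverse_n])
  then have "(\<lambda>n. 1 + (a - 1) * inverse (of_nat (Suc n))) \<longlonglongrightarrow> 1 + (a - 1) * 0"
    by (intro tendsto_intros)
  moreover have "1 + (a - 1) * inverse (of_nat (Suc n)) = (of_nat n + a) / of_nat (Suc n) powr 1" for n
    by (simp add: field_simps del: of_nat_Suc) (simp add: algebra_simps)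
  ultimately show ?thesis by (simp add: has_growth_def del: of_nat_Suc)
qed

text \<open>For complex \<open>\<alpha>\<close> the ratio is the exponential of
  \<open>\<alpha>\<close> times a difference of real logarithms, and that difference tends to
  0.\<close>

lemma powr_shift_ratio:
  "(\<lambda>n. of_nat (Suc n) powr \<alpha> / of_nat (Suc (n + k)) powr \<alpha>) \<longlonglongrightarrow> (1 :: complex)"
proof -
  have "(\<lambda>n. ln (real (Suc n)) - ln (real (Suc (n + k)))) \<longlonglongrightarrow> 0"
    by real_asymp
  then have "(\<lambda>n. exp (\<alpha> * of_real (ln (real (Suc n)) - ln (real (Suc (n + k)))))) \<longlonglongrightarrow> exp (\<alpha> * of_real 0)"
    by (intro tendsto_intros)
  moreover have "of_nat (Suc n) powr \<alpha> = exp (\<alpha> * of_real (ln (real (Suc n))))" for n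
    by (simp add: powr_def Ln_of_nat del: of_nat_Suc)
  ultimately show ?thesis
    by (simp add: exp_diff right_diff_distrib del: of_nat_Suc)
qed

text \<open>This is the Gauss product for \<open>1 / Gamma\<close>, rewritten from
  \<open>rGamma_series\<close>. Stating the limit with \<open>rGamma\<close> covers nonpositive
  integers \<open>x\<close> too, where it is 0.\<close>

lemma has_growth_pochhammer:
  "has_growth (\<lambda>n. pochhammer x n / fact n) (x - 1) (rGamma x)"
proof -
  let ?q = "\<lambda>n. pochhammer x n / fact n / of_nat (Suc n) powr (x - 1)"
  have "(\<lambda>n. (of_nat (Suc n) :: complex) / of_nat (Suc (n + 1))) \<longlonglongrightarrow> 1"
    using powr_shift_ratio[of 1 1] by (simp del: of_nat_Suc)
  from LIMSEQ_Suc[OF tendsto_inverse[OF this]]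
  have a: "(\<lambda>n. (of_nat (Suc (Suc (Suc n))) :: complex) / of_nat (Suc (Suc n))) \<longlonglongrightarrow> 1"
    by (simp add: add.commute del: of_nat_Suc)
  have b: "(\<lambda>n. rGamma_series x (Suc n)) \<longlonglongrightarrow> rGamma x"
    by (rule LIMSEQ_Suc[OF rGamma_series_LIMSEQ])
  have "(\<lambda>n. rGamma_series x (Suc n) * (of_nat (Suc n) powr x / of_nat (Suc (n + 2)) powr x)
      * (of_nat (Suc (Suc (Suc n))) / of_nat (Suc (Suc n)))) \<longlonglongrightarrow> rGamma x * 1 * 1"
    by (intro tendsto_mult b powr_shift_ratio a)
  \<comment> \<open>The Pochhammer symbol in \<open>rGamma_series x (Suc n)\<close> has length
    \<open>n + 2\<close>, hence the offset. The index \<open>Suc n\<close> keeps the logarithm away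
    from 0, and the two ratios only change the base of the power and the factorial.\<close>
  moreover have "?q (n + 2) = rGamma_series x (Suc n) *
      (of_nat (Suc n) powr x / of_nat (Suc (n + 2)) powr x) *
      (of_nat (Suc (Suc (Suc n))) / of_nat (Suc (Suc n)))" for n
  proof -
    have e: "exp (x * of_real (ln (of_nat (Suc n)))) = of_nat (Suc n) powr x"
      by (simp add: powr_def Ln_of_nat del: of_nat_Suc)
    have "fact (n + 2) = (fact (Suc n) * of_nat (Suc (Suc n)) :: complex)"
      by (simp add: algebra_simps del: of_nat_Suc)
    then show ?thesis
      unfolding rGamma_series_def e
      by (simp add: powr_diff field_simps del: of_nat_Suc fact_Suc)
  qed
  ultimately have "(\<lambda>n. ?q (n + 2)) \<longlonglongrightarrow> rGamma x" by simp
  then show ?thesis unfolding has_growth_def by (rule LIMSEQ_offset)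
qed

lemma norm_of_nat_powr: "norm (of_nat (Suc n) powr (\<alpha> :: complex)) = real (Suc n) powr Re \<alpha>"
  by (subst norm_powr_real_powr) (auto simp del: of_nat_Suc)

lemma has_growth_bound:
  assumes "has_growth f \<alpha> L"
  obtains C where "C \<ge> 0" "\<And>n. norm (f n) \<le> C * real (Suc n) powr Re \<alpha>"
proof -
  from assms have "Bseq (\<lambda>n. f n / of_nat (Suc n) powr \<alpha>)"
    unfolding has_growth_def by (rule convergent_imp_Bseq[OF convergentI])
  then obtain C where C: "C > 0" "\<And>n. norm (f n / of_nat (Suc n) powr \<alpha>) \<le> C"
    by (auto elim: BseqE)
  have "norm (f n) \<le> C * real (Suc n) powr Re \<alpha>" for n
    using C(2)[of n] by (simp add: norm_divide norm_of_nat_powr field_simps del: of_nat_Suc)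
  with C(1) show thesis by (intro that[of C]) auto
qed

text \<open>Comparison with a convergent series of real powers.\<close>

lemma has_growth_summable:
  assumes "has_growth f \<alpha> L" "Re \<alpha> < -1"
  shows "summable (\<lambda>n. norm (f n))"
proof -
  obtain C where C: "C \<ge> 0" "\<And>n. norm (f n) \<le> C * real (Suc n) powr Re \<alpha>"
    using has_growth_bound[OF assms(1)] by blast
  have "summable (\<lambda>n. real n powr Re \<alpha>)"
    using assms(2) by (simp add: summable_real_powr_iff)
  then have "summable (\<lambda>n. C * real (Suc n) powr Re \<alpha>)"
    by (intro summable_mult) (subst summable_Suc_iff)
  then show ?thesis
    by (rule summable_comparison_test[rotated]) (use C in auto)
qed

text \<open>Tannery's theorem: for fixed \<open>k\<close> the normalised weight at
  \<open>M - k\<close> tends to \<open>L\<close>, and the summable sequence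
  \<open>C * norm (t k)\<close> dominates uniformly in \<open>M\<close>. This is the passage from
  truncated sums to infinite series.\<close>

lemma has_growth_convolution:
  assumes f: "has_growth f \<alpha> L" and \<alpha>: "Re \<alpha> \<ge> 0" and t: "summable (\<lambda>n. norm (t n))"
  shows "(\<lambda>M. (\<Sum>k\<le>M. t k * f (M - k)) / of_nat (Suc M) powr \<alpha>) \<longlonglongrightarrow> L * suminf t"
proof -
  obtain C where C: "C \<ge> 0" "\<And>n. norm (f n) \<le> C * real (Suc n) powr Re \<alpha>"
    using has_growth_bound[OF f] by blast
  \<comment> \<open>Extension by zero beyond \<open>M\<close> turns the finite sums into full series
    over a common index set.\<close>
  define a where "a k M = (if k \<le> M then t k * f (M - k) / of_nat (Suc M) powr \<alpha> else 0)" for k M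
  have lim: "(\<lambda>M. a k M) \<longlonglongrightarrow> t k * L" for k
  proof -
    have "(\<lambda>n. t k * (f n / of_nat (Suc n) powr \<alpha>) *
        (of_nat (Suc n) powr \<alpha> / of_nat (Suc (n + k)) powr \<alpha>)) \<longlonglongrightarrow> t k * L * 1"
      using f unfolding has_growth_def by (intro tendsto_intros powr_shift_ratio)
    then have "(\<lambda>n. a k (n + k)) \<longlonglongrightarrow> t k * L"
      by (simp add: a_def del: of_nat_Suc)
    then show ?thesis by (rule LIMSEQ_offset)
  qed
  have bound: "norm (a k M) \<le> C * norm (t k)" for k M
  proof (cases "k \<le> M")
    case True
    have "norm (f (M - k)) \<le> C * real (Suc (M - k)) powr Re \<alpha>" by (rule C)
    \<comment> \<open>Here \<open>Re \<alpha> \<ge> 0\<close> enters: the bound at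
      \<open>M - k\<close> is at most the one at \<open>M\<close>.\<close>
    also have "\<dots> \<le> C * real (Suc M) powr Re \<alpha>"
      using C(1) \<alpha> by (intro mult_left_mono powr_mono2) auto
    finally have "norm (t k) * norm (f (M - k)) \<le> norm (t k) * (C * real (Suc M) powr Re \<alpha>)"
      by (rule mult_left_mono) auto
    then show ?thesis using True
      by (simp add: a_def norm_divide norm_mult norm_of_nat_powr field_simps del: of_nat_Suc)
  qed (use C in \<open>auto simp: a_def\<close>)
  have "(\<lambda>M. \<Sum>k. a k M) \<longlonglongrightarrow> (\<Sum>k. t k * L)"
    using tannerys_theorem[OF lim, where M = "\<lambda>k. C * norm (t k)"] bound summable_mult[OF t]
    by (simp add: case_prod_unfold)
  moreover have "(\<Sum>k. a k M) = (\<Sum>k\<le>M. t k * f (M - k)) / of_nat (Suc M) powr \<alpha>" for M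
    by (subst suminf_finite[of "{..M}"]) (auto simp: a_def sum_divide_distrib simp del: of_nat_Suc)
  moreover have "(\<Sum>k. t k * L) = L * suminf t"
    using suminf_mult2[OF summable_norm_cancel[OF t], of L] by (simp add: mult.commute)
  ultimately show ?thesis by simp
qed

section \<open>Digamma function: telescoping, asymptotics and reflection\<close>

lemma sum_inverse_shift_eq_Digamma:
  fixes a :: complex
  assumes "\<And>i. i < n \<Longrightarrow> a + of_nat i \<noteq> 0"
  shows "(\<Sum>i<n. 1 / (a + of_nat i)) = Digamma (a + of_nat n) - Digamma a"
  using assms
proof (induction n)
  case (Suc n)
  have "Digamma (a + of_nat (Suc n)) = Digamma (a + of_nat n + 1)" by (simp add: add_ac)
  also have "\<dots> = Digamma (a + of_nat n) + 1 / (a + of_nat n)"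
    using Suc.prems[of n] by (intro Digamma_plus1) auto
  finally show ?case using Suc by simp
qed simp

lemma Digamma_shift_asymp:
  fixes a :: complex
  assumes "a \<notin> \<int>\<^sub>\<le>\<^sub>0"
  shows "(\<lambda>n. Digamma (a + of_nat n) - of_real (ln (real n))) \<longlonglongrightarrow> 0"
proof -
  have nz: "a + of_nat i \<noteq> 0" for i
    using assms by (auto simp: add_eq_0_iff2)
  have "(\<lambda>m. Digamma a - (of_real (ln (real m)) - (\<Sum>n<m. inverse (a + of_nat n)))) \<longlonglongrightarrow> Digamma a - Digamma a"
    using nz[of 0] by (intro tendsto_intros Digamma_LIMSEQ) auto
  then show ?thesis
    using sum_inverse_shift_eq_Digamma[of _ a] nz by (simp add: inverse_eq_divide algebra_simps)
qed

text \<open>Each entry contributes one \<open>ln n\<close>, so in a difference of such sums with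
  equally many terms on both sides the logarithms cancel.\<close>

lemma sum_list_Digamma_shift_asymp:
  fixes xs :: "complex list"
  assumes "\<And>x. x \<in> set xs \<Longrightarrow> x \<notin> \<int>\<^sub>\<le>\<^sub>0"
  shows "(\<lambda>n. sum_list (map (\<lambda>x. Digamma (x + of_nat n)) xs)
     - of_nat (length xs) * of_real (ln (real n))) \<longlonglongrightarrow> 0"
  using assms
proof (induction xs)
  case (Cons x xs)
  have "(\<lambda>n. (Digamma (x + of_nat n) - of_real (ln (real n))) +
     (sum_list (map (\<lambda>x. Digamma (x + of_nat n)) xs) - of_nat (length xs) * of_real (ln (real n)))) \<longlonglongrightarrow> 0 + 0"
    using Cons by (intro tendsto_add Digamma_shift_asymp) auto
  then show ?case by (simp add: algebra_simps)
qed simp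

text \<open>Differentiate both sides of the reflection formula for
  \<open>Gamma z * Gamma (1 - z)\<close> and compare the two derivatives.\<close>

lemma Digamma_reflection:
  fixes z :: complex
  assumes z: "z \<notin> \<int>"
  shows "Digamma (1 - z) = Digamma z + of_real pi * cot (of_real pi * z)"
proof -
  have z1: "1 - z \<notin> \<int>" using z by (metis Ints_1 Ints_diff diff_diff_eq2 add_diff_cancel_left')
  have nonpos: "z \<notin> \<int>\<^sub>\<le>\<^sub>0" "1 - z \<notin> \<int>\<^sub>\<le>\<^sub>0" using z z1 nonpos_Ints_subset_Ints by auto
  have sin: "sin (of_real pi * z) \<noteq> 0"
  proof
    assume "sin (of_real pi * z) = 0"
    then obtain n :: int where "of_real pi * z = of_real (of_int n * pi)"
      unfolding sin_eq_0 by (auto simp: mult_ac)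
    then have "z = of_int n" by simp
    with z show False by auto
  qed
  define R :: "complex \<Rightarrow> complex" where "R = (\<lambda>z. of_real pi / sin (of_real pi * z))"
  have "((\<lambda>z. Gamma z * Gamma (1 - z)) has_field_derivative
      Gamma z * Gamma (1 - z) * (Digamma z - Digamma (1 - z))) (at z)"
    using nonpos by (auto intro!: derivative_eq_intros simp: algebra_simps)
  moreover have "(\<lambda>z. Gamma z * Gamma (1 - z)) = R"
    by (simp add: R_def Gamma_reflection_complex fun_eq_iff)
  ultimately have "(R has_field_derivative R z * (Digamma z - Digamma (1 - z))) (at z)"
    by (metis (no_types, lifting))
  moreover have "(R has_field_derivative R z * (- of_real pi * cot (of_real pi * z))) (at z)"
    using sin unfolding R_def
    by (auto intro!: derivative_eq_intros simp: cot_def field_simps power2_eq_square)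
  ultimately have "R z * (Digamma z - Digamma (1 - z)) = R z * (- of_real pi * cot (of_real pi * z))"
    by (rule DERIV_unique)
  then have "Digamma z - Digamma (1 - z) = - of_real pi * cot (of_real pi * z)"
    using sin by (subst (asm) mult_cancel_left) (auto simp: R_def)
  then show ?thesis by (simp add: algebra_simps)
qed

lemma cot_pi_add_of_nat:
  fixes z :: complex
  shows "cot (of_real pi * (z + of_nat k)) = cot (of_real pi * z)"
proof (induction k)
  case (Suc k)
  have "of_real pi * (z + of_nat (Suc k)) = of_real pi * (z + of_nat k) + of_real pi"
    by (simp add: algebra_simps)
  then show ?case using Suc by (simp only: cot_def sin_add cos_add) (simp add: sin_of_real cos_of_real)
qed simp

subsection \<open>Products over parameter lists\<close>

text \<open>The first \<open>k\<close> factors, reversed and negated, form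
  \<open>pochhammer (1 - y) k\<close>; the last \<open>r\<close> form \<open>pochhammer y r\<close>.
  At the \<open>k\<close>-th pole this separates the series coefficient from the weight in
  \<open>r = M - k\<close>.\<close>

lemma pochhammer_diff_split:
  fixes y :: complex
  shows "pochhammer (y - of_nat k) (k + r) = (-1) ^ k * pochhammer (1 - y) k * pochhammer y r"
  using pochhammer_minus[of "of_nat k - y" k] by (simp add: pochhammer_product')

text \<open>Isolates the single factor that vanishes at \<open>s = a + i\<close>.\<close>

lemma pochhammer_factor_out:
  fixes a s :: complex
  shows "pochhammer (a - s) (i + Suc r)
    = pochhammer (a - s) i * pochhammer (a + of_nat i + 1 - s) r * (a + of_nat i - s)"
  by (simp only: pochhammer_product' pochhammer_rec) (simp add: algebra_simps)

lemma pochhammer_of_nat_Suc: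
  "pochhammer (of_nat (Suc j)) n = (fact (j + n) / fact j :: complex)"
  using pochhammer_product'[of "1::complex" j n] by (simp add: pochhammer_fact[symmetric] add.commute)

lemma pochhammer_add_of_nat:
  fixes y :: complex
  assumes "pochhammer y q \<noteq> 0"
  shows "pochhammer (y + of_nat q) n = pochhammer y (q + n) / pochhammer y q"
  using assms by (simp add: pochhammer_product')

lemma prod_list_remove_nth:
  fixes g :: "'a \<Rightarrow> 'b :: comm_monoid_mult"
  assumes "j < length xs"
  shows "prod_list (map g xs) = g (xs ! j) * prod_list (map g (remove_nth j xs))"
  by (subst id_take_nth_drop[OF assms]) (simp add: remove_nth_def mult_ac)

lemma sum_list_remove_nth:
  fixes g :: "'a \<Rightarrow> 'b :: comm_monoid_add"
  assumes "j < length xs"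
  shows "sum_list (map g xs) = g (xs ! j) + sum_list (map g (remove_nth j xs))"
  by (subst id_take_nth_drop[OF assms]) (simp add: remove_nth_def add_ac)

lemma length_remove_nth: "j < length xs \<Longrightarrow> length (remove_nth j xs) = length xs - 1"
  by (simp add: remove_nth_def)

lemma set_remove_nthE:
  assumes "x \<in> set (remove_nth j xs)" "j < length xs"
  obtains i where "i < length xs" "i \<noteq> j" "x = xs ! i"
proof -
  from assms(1) consider "x \<in> set (take j xs)" | "x \<in> set (drop (Suc j) xs)"
    by (auto simp: remove_nth_def)
  then show thesis
  proof cases
    case 1
    then obtain i where "i < length (take j xs)" "x = take j xs ! i" by (metis in_set_conv_nth)
    then show thesis using that[of i] by auto
  next
    case 2
    then obtain i where "i < length (drop (Suc j) xs)" "x = drop (Suc j) xs ! i" by (metis in_set_conv_nth)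
    then show thesis using that[of "Suc j + i"] by auto
  qed
qed

lemma prod_list_mult_distrib:
  fixes f g :: "'a \<Rightarrow> complex"
  shows "prod_list (map (\<lambda>x. f x * g x) xs) = prod_list (map f xs) * prod_list (map g xs)"
  by (induction xs) auto

lemma prod_list_divide_distrib:
  fixes f g :: "'a \<Rightarrow> complex"
  shows "prod_list (map (\<lambda>x. f x / g x) xs) = prod_list (map f xs) / prod_list (map g xs)"
  by (induction xs) auto

lemma prod_list_const: "prod_list (map (\<lambda>_. a) xs) = (a :: complex) ^ length xs"
  by (induction xs) auto

lemma poch_vec_map: "poch_vec (map g xs) n = prod_list (map (\<lambda>x. pochhammer (g x) n) xs)"
  by (simp add: poch_vec_def o_def)

lemma poch_vec_nonzero: "(\<And>x. x \<in> set xs \<Longrightarrow> x \<notin> \<int>\<^sub>\<le>\<^sub>0) \<Longrightarrow> poch_vec xs n \<noteq> 0"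
  by (induction xs) (auto simp: poch_vec_def dest: pochhammer_eq_0_imp_nonpos_Int)

text \<open>The sign is kept as a power of \<open>(-1) ^ k\<close> so that numerator and denominator
  can be compared through their numbers of parameters.\<close>

lemma prod_list_pochhammer_diff_split:
  "prod_list (map (\<lambda>x. pochhammer (g x - of_nat k) (k + r)) xs)
    = ((-1) ^ k) ^ length xs * poch_vec (map (\<lambda>x. 1 - g x) xs) k * poch_vec (map g xs) r"
  by (simp add: pochhammer_diff_split prod_list_mult_distrib prod_list_const poch_vec_map)

lemma minus_one_power_cancel: "((-1) ^ k :: complex) ^ (n + 2) = ((-1) ^ k) ^ n"
  by (simp add: power_add flip: power_mult)

lemma one_minus_notin_Ints: "x \<notin> \<int> \<Longrightarrow> 1 - x \<notin> (\<int> :: complex set)"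
  by (metis Ints_1 Ints_diff diff_diff_eq2 add_diff_cancel_left')

lemma pochhammer_nonint_nonzero: "x \<notin> \<int> \<Longrightarrow> pochhammer (x :: complex) n \<noteq> 0"
  using pochhammer_eq_0_imp_nonpos_Int nonpos_Ints_subset_Ints by blast

section \<open>Logarithmic derivatives at the integer points\<close>

lemma one_minus_shift_nonzero: "x \<notin> \<int> \<Longrightarrow> 1 - x - of_nat k + of_nat i \<noteq> (0 :: complex)"
proof
  assume x: "x \<notin> \<int>" and e: "1 - x - of_nat k + of_nat i = 0"
  then have "x = 1 - of_nat k + of_nat i" by (simp add: algebra_simps)
  then show False using x by (metis Ints_1 Ints_add Ints_diff Ints_of_nat)
qed

text \<open>The reciprocals telescope to \<open>Digamma (1 - x + r) - Digamma (1 - x - k)\<close>.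
  Reflection and the periodicity of the cotangent turn the last value into
  \<open>Digamma (x + k)\<close> plus a term independent of \<open>k\<close>: this is the source of
  the cotangents in the result.\<close>

lemma has_logderiv_pochhammer_nonint:
  assumes "x \<notin> \<int>"
  shows "has_logderiv (\<lambda>s. pochhammer (1 - x - s) (k + r))
    (Digamma (x + of_nat k) + of_real pi * cot (of_real pi * x) - Digamma (1 - x + of_nat r)) (of_nat k)"
proof -
  have "x + of_nat k \<notin> \<int>" using assms by (metis Ints_diff Ints_of_nat add_diff_cancel_right')
  from Digamma_reflection[OF this]
  have "Digamma (1 - (x + of_nat k)) = Digamma (x + of_nat k) + of_real pi * cot (of_real pi * x)"
    by (simp only: cot_pi_add_of_nat)
  then have "(\<Sum>i<k + r. 1 / (1 - x - of_nat k + of_nat i))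
     = Digamma (1 - x + of_nat r) - (Digamma (x + of_nat k) + of_real pi * cot (of_real pi * x))"
    using sum_inverse_shift_eq_Digamma[of "k + r" "1 - x - of_nat k"] one_minus_shift_nonzero[OF assms]
    by (simp add: algebra_simps)
  then show ?thesis
    using has_logderiv_pochhammer[of "k + r" "1 - x" "of_nat k"] one_minus_shift_nonzero[OF assms] by simp
qed

text \<open>At \<open>s = k\<close> the factors are \<open>1, ..., r\<close>, so a harmonic number
  appears.\<close>

lemma has_logderiv_pochhammer_upper:
  "has_logderiv (\<lambda>s. pochhammer (of_nat k + 1 - s) r) (Digamma 1 - Digamma (of_nat r + 1)) (of_nat k)"
proof -
  have nz: "1 + of_nat i \<noteq> (0 :: complex)" for i
    by (metis of_nat_Suc of_nat_eq_0_iff nat.distinct(1))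
  have "(\<Sum>i<r. 1 / (1 + of_nat i :: complex)) = Digamma (1 + of_nat r) - Digamma 1"
    by (rule sum_inverse_shift_eq_Digamma) (rule nz)
  then show ?thesis
    using has_logderiv_pochhammer[of r "of_nat k + 1" "of_nat k"] nz by (simp add: add.commute)
qed

text \<open>At \<open>s = k\<close> the factors are \<open>-(m + k), ..., -1\<close>: again a
  harmonic number, with reversed order and opposite sign.\<close>

lemma has_logderiv_pochhammer_lower:
  "has_logderiv (\<lambda>s. pochhammer (- of_nat m - s) (m + k))
     (Digamma (1 + of_nat m + of_nat k) - Digamma 1) (of_nat k)"
proof -
  have nz: "1 + of_nat i \<noteq> (0 :: complex)" for i
    by (metis of_nat_Suc of_nat_eq_0_iff nat.distinct(1))
  have nz': "- of_nat m - of_nat k + of_nat i \<noteq> (0 :: complex)" if "i < m + k" for i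
  proof -
    have "of_nat i \<noteq> (of_nat (m + k) :: complex)" using that by (subst of_nat_eq_iff) simp
    then show ?thesis by (auto simp: algebra_simps)
  qed
  have "(\<Sum>i<m + k. 1 / (- of_nat m - of_nat k + of_nat i :: complex))
     = (\<Sum>i<m + k. - (1 / (1 + of_nat i)))"
  proof (rule sum.reindex_bij_witness[where i = "\<lambda>i. m + k - Suc i" and j = "\<lambda>i. m + k - Suc i"])
    fix i assume i: "i \<in> {..<m + k}"
    then have "(of_nat (m + k - Suc i) :: complex) = of_nat m + of_nat k - of_nat i - 1"
      by (simp add: of_nat_diff algebra_simps)
    then have "1 + of_nat (m + k - Suc i) = - (- of_nat m - of_nat k + of_nat i :: complex)"
      by (simp add: algebra_simps)
    then show "- (1 / (1 + of_nat (m + k - Suc i))) = 1 / (- of_nat m - of_nat k + of_nat i :: complex)"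
      by (simp only: divide_minus_right minus_minus)
  qed auto
  also have "\<dots> = - (Digamma (1 + of_nat (m + k)) - Digamma 1)"
    unfolding sum_negf by (subst sum_inverse_shift_eq_Digamma) (use nz in auto)
  finally show ?thesis
    using has_logderiv_pochhammer[of "m + k" "- of_nat m" "of_nat k"] nz' by (simp add: add_ac)
qed

section \<open>Growth of products over parameter lists\<close>

lemma poch_vec_Cons: "poch_vec (x # xs) n = pochhammer x n * poch_vec xs n"
  by (simp add: poch_vec_def)

lemma has_growth_poch_vec:
  "has_growth (\<lambda>n. poch_vec xs n / fact n ^ length xs) (sum_list xs - of_nat (length xs))
     (prod_list (map rGamma xs))"
proof -
  have "poch_vec xs n / fact n ^ length xs = prod_list (map (\<lambda>x. pochhammer x n / fact n) xs)" for n
    unfolding poch_vec_def prod_list_divide_distrib prod_list_const by simp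
  moreover have "sum_list xs - of_nat (length xs) = sum_list (map (\<lambda>x. x - 1) xs)"
    by (induction xs) auto
  ultimately show ?thesis
    using has_growth_prod_list[of xs "\<lambda>x n. pochhammer x n / fact n" "\<lambda>x. x - 1" rGamma]
      has_growth_pochhammer by simp
qed

lemma prod_list_rGamma: "prod_list (map rGamma xs) = inverse (Gamma_vec xs)"
  by (induction xs) (auto simp: Gamma_vec_def rGamma_inverse_Gamma)

lemma prod_list_rGamma_nonzero:
  "(\<And>x. x \<in> set xs \<Longrightarrow> x \<notin> \<int>) \<Longrightarrow> prod_list (map rGamma xs) \<noteq> (0 :: complex)"
  using nonpos_Ints_subset_Ints by (induction xs) (auto simp: rGamma_eq_zero_iff)

lemma sum_list_diff_const: "sum_list (map (\<lambda>x. x - a) xs) = sum_list xs - of_nat (length xs) * (a :: complex)"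
  by (induction xs) (auto simp: algebra_simps)

lemma sum_list_const_diff: "sum_list (map (\<lambda>x. a - x) xs) = of_nat (length xs) * (a :: complex) - sum_list xs"
  by (induction xs) (auto simp: algebra_simps)

text \<open>Used to make the constant residue total \<open>-1\<close> disappear after division by
  the growing power.\<close>

lemma inverse_powr_tendsto_0:
  assumes "Re \<alpha> > 0" shows "(\<lambda>n. a / of_nat (Suc n) powr \<alpha> :: complex) \<longlonglongrightarrow> 0"
proof (rule Lim_null_comparison)
  have "(\<lambda>n. real (Suc n) powr - Re \<alpha>) \<longlonglongrightarrow> 0"
    by (rule LIMSEQ_Suc[OF tendsto_neg_powr])
      (use assms in \<open>auto intro: filterlim_real_sequentially\<close>)
  then show "(\<lambda>n. norm a * real (Suc n) powr - Re \<alpha>) \<longlonglongrightarrow> 0"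
    by (rule tendsto_mult_right_zero)
  show "\<forall>\<^sub>F n in sequentially. norm (a / of_nat (Suc n) powr \<alpha>) \<le> norm a * real (Suc n) powr - Re \<alpha>"
    by (simp add: norm_mult norm_inverse norm_of_nat_powr powr_minus divide_inverse del: of_nat_Suc)
qed

text \<open>Handles the poles at negative integers, whose weights are evaluated at a fixed distance
  beyond \<open>M\<close>.\<close>

lemma has_growth_shift:
  assumes "has_growth f \<alpha> L"
  shows "(\<lambda>M. f (k + M) / of_nat (Suc M) powr \<alpha>) \<longlonglongrightarrow> L"
proof -
  have "(\<lambda>M. f (M + k) / of_nat (Suc (M + k)) powr \<alpha>) \<longlonglongrightarrow> L"
    using assms unfolding has_growth_def by (rule LIMSEQ_ignore_initial_segment)
  from tendsto_divide[OF this powr_shift_ratio[of \<alpha> k]]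
  show ?thesis by (simp add: add.commute del: of_nat_Suc)
qed

subsection \<open>The truncated identity and its limit\<close>

locale hypergeometric_parameters =
  fixes c d :: "complex list" and m :: nat
  assumes len: "length c = length d + 2"
    and c_nonint: "\<And>x. x \<in> set c \<Longrightarrow> x \<notin> \<int>"
    and d_nonint: "\<And>x. x \<in> set d \<Longrightarrow> x \<notin> \<int>"
    and d_distinct: "\<And>j k. j < length d \<Longrightarrow> k < length d \<Longrightarrow> j \<noteq> k \<Longrightarrow> d ! j - d ! k \<notin> \<int>"
begin

text \<open>The lengths \<open>Suc M\<close> and \<open>m + Suc M\<close> make both integer products
  end with the factor \<open>M - s\<close>, so \<open>0, ..., M\<close> are double zeros of their
  product and \<open>-m, ..., -1\<close> simple ones. By \<open>len\<close> the numerator has degree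
  one less than the denominator.\<close>

definition ratfun :: "nat \<Rightarrow> complex \<Rightarrow> complex" where
  "ratfun M s = prod_list (map (\<lambda>x. pochhammer (1 - x - s) M) c) * (of_nat (Suc M) - s) ^ Suc m /
     (prod_list (map (\<lambda>x. pochhammer (1 - x - s) M) d) * pochhammer (0 - s) (Suc M) *
      pochhammer (- of_nat m - s) (m + Suc M))"

definition coef :: "nat \<Rightarrow> complex" where
  "coef k = poch_vec c k / (poch_vec d k * fact (m + k) * fact k)"

definition brace :: "nat \<Rightarrow> complex" where
  "brace k = sum_list (map (\<lambda>x. Digamma (x + of_nat k)) d) + Digamma (of_nat k + 1)
     + Digamma (1 + of_nat m + of_nat k) - sum_list (map (\<lambda>x. Digamma (x + of_nat k)) c)"

definition cot_diff :: complex where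
  "cot_diff = of_real pi * (sum_list (map (\<lambda>x. cot (of_real pi * x)) c)
     - sum_list (map (\<lambda>x. cot (of_real pi * x)) d))"

text \<open>The part of the residue at \<open>k\<close> that depends only on
  \<open>r = M - k\<close>. The factor \<open>(of_nat r + 1) ^ Suc m\<close> is the extra factor of
  \<open>ratfun M\<close> at \<open>s = k\<close>.\<close>

definition weight :: "nat \<Rightarrow> complex" where
  "weight r = poch_vec (map (\<lambda>x. 1 - x) c) r * (of_nat r + 1) ^ Suc m /
     (poch_vec (map (\<lambda>x. 1 - x) d) r * fact r ^ 2)"

text \<open>The part of the logarithmic derivative at \<open>k\<close> that depends only on
  \<open>r = M - k\<close>; the last term comes from the extra factor of
  \<open>ratfun M\<close>.\<close>

definition remainder :: "nat \<Rightarrow> complex" where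
  "remainder r = sum_list (map (\<lambda>x. Digamma (1 - x + of_nat r)) d) + 2 * Digamma (of_nat r + 1)
     - sum_list (map (\<lambda>x. Digamma (1 - x + of_nat r)) c) - of_nat (Suc m) / (of_nat r + 1)"

definition dcoef :: "nat \<Rightarrow> nat \<Rightarrow> complex" where
  "dcoef j n = poch_vec (map (\<lambda>x. 1 + x - d ! j) c) n /
     poch_vec ([2 - d ! j, 2 - d ! j + of_nat m] @ map (\<lambda>x. 1 + x - d ! j) (remove_nth j d)) n / fact n"

text \<open>\<open>of_nat r / fact r\<close> stands for \<open>1 / (r - 1)!\<close>, and makes the weight vanish at \<open>r = 0\<close>, where there is no pole.\<close>
definition dweight :: "nat \<Rightarrow> nat \<Rightarrow> complex" where
  "dweight j r = poch_vec (map (\<lambda>x. d ! j - x) c) r * (of_nat r + d ! j) ^ Suc m * of_nat r /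
     (poch_vec (map (\<lambda>x. d ! j - x) (remove_nth j d)) r * fact r * pochhammer (d ! j - 1) (Suc r)
      * pochhammer (d ! j - 1 - of_nat m) (m + Suc r))"

lemma d_nth_nonint: "j < length d \<Longrightarrow> d ! j \<notin> \<int>"
  using d_nonint by simp

lemma d_nth_diff_nonint: "j < length d \<Longrightarrow> x \<in> set (remove_nth j d) \<Longrightarrow> d ! j - x \<notin> \<int>"
  by (metis set_remove_nthE d_distinct)

lemma poch_vec_one_minus_nonzero:
  "poch_vec (map (\<lambda>x. 1 - x) c) n \<noteq> 0" "poch_vec (map (\<lambda>x. 1 - x) d) n \<noteq> 0"
proof -
  have "1 - x \<notin> \<int>\<^sub>\<le>\<^sub>0" if "x \<notin> \<int>" for x :: complex
    using one_minus_notin_Ints[OF that] nonpos_Ints_subset_Ints by auto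
  then show "poch_vec (map (\<lambda>x. 1 - x) c) n \<noteq> 0" "poch_vec (map (\<lambda>x. 1 - x) d) n \<noteq> 0"
    using c_nonint d_nonint by (auto intro!: poch_vec_nonzero)
qed

section \<open>Residues at the three families of poles\<close>

definition ncoef :: "nat \<Rightarrow> complex" where
  "ncoef j = (-1) ^ j * fact j * poch_vec (map (\<lambda>x. 1 - x) d) (Suc j) /
     (poch_vec (map (\<lambda>x. 1 - x) c) (Suc j) * fact (m - 1 - j))"

text \<open>At a double pole the residue is the value of the regular part times its logarithmic
  derivative. The value splits into \<open>coef k\<close> and \<open>weight r\<close>, the
  derivative into cotangents, digammas at \<open>k\<close> and digammas at \<open>r\<close>.\<close>

lemma residue_ratfun_nat:
  "residue (ratfun (k + r)) (of_nat k)
    = (-1) ^ m * coef k * weight r * (cot_diff - brace k + remainder r)"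
proof -
  let ?z = "of_nat k :: complex"
  define num where "num = (\<lambda>s. prod_list (map (\<lambda>x. pochhammer (1 - x - s) (k + r)) c) *
     (of_nat (Suc (k + r)) - s) ^ Suc m)"
  \<comment> \<open>Both vanishing factors \<open>k - s\<close> are removed. The forms
    \<open>of_nat 0\<close> and \<open>0 + k\<close> let
    \<open>has_logderiv_pochhammer_lower\<close> apply with \<open>m = 0\<close>.\<close>
  define den where "den = (\<lambda>s. prod_list (map (\<lambda>x. pochhammer (1 - x - s) (k + r)) d) *
     (pochhammer (- of_nat 0 - s) (0 + k) * pochhammer (of_nat k + 1 - s) r) *
     (pochhammer (- of_nat m - s) (m + k) * pochhammer (of_nat k + 1 - s) r))"
  define l :: "complex \<Rightarrow> complex" where "l = (\<lambda>x. Digamma (x + of_nat k) + of_real pi * cot (of_real pi * x)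
     - Digamma (1 - x + of_nat r))"
  \<comment> \<open>Here \<open>ln\<close> and \<open>ld\<close> are the logarithmic derivatives of
    \<open>num\<close> and \<open>den\<close>; \<open>ln\<close> shadows the logarithm.\<close>
  define ln where "ln = sum_list (map l c) + of_nat (Suc m) * (- 1 / (of_nat (Suc (k + r)) - of_nat k))"
  define ld where "ld = sum_list (map l d)
     + (Digamma (1 + of_nat 0 + of_nat k) - Digamma 1 + (Digamma 1 - Digamma (of_nat r + 1)))
     + (Digamma (1 + of_nat m + of_nat k) - Digamma 1 + (Digamma 1 - Digamma (of_nat r + 1)))"
  have eq: "ratfun (k + r) = (\<lambda>s. num s / (den s * (s - ?z)^2))"
  proof
    fix s :: complex
    have "pochhammer (0 - s) (Suc (k + r))
        = pochhammer (0 - s) k * pochhammer (of_nat k + 1 - s) r * (of_nat k - s)"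
      using pochhammer_factor_out[of 0 s k r] by simp
    moreover have "pochhammer (- of_nat m - s) (m + Suc (k + r))
        = pochhammer (- of_nat m - s) (m + k) * pochhammer (of_nat k + 1 - s) r * (of_nat k - s)"
      using pochhammer_factor_out[of "- of_nat m" s "m + k" r] by (simp add: add_ac)
    moreover have "(s - ?z)^2 = (of_nat k - s) * (of_nat k - s)"
      by (simp add: power2_eq_square algebra_simps)
    ultimately show "ratfun (k + r) s = num s / (den s * (s - ?z)^2)"
      by (simp only: ratfun_def num_def den_def of_nat_0 minus_zero add_0 mult_ac)
  qed
  have hol: "num holomorphic_on UNIV" "den holomorphic_on UNIV"
    unfolding num_def den_def
    by (intro holomorphic_intros holomorphic_on_prod_list holomorphic_on_pochhammer_diff)+
  have lin: "of_nat (Suc (k + r)) \<noteq> (of_nat k :: complex)"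
    by (subst of_nat_eq_iff) simp
  have "has_logderiv num ln ?z"
    unfolding num_def ln_def l_def
    by (intro has_logderiv_mult has_logderiv_prod_list has_logderiv_pochhammer_nonint has_logderiv_power
        has_logderiv_linear c_nonint lin)
  moreover have den: "has_logderiv den ld ?z"
    unfolding den_def ld_def l_def
    by (intro has_logderiv_mult has_logderiv_prod_list has_logderiv_pochhammer_nonint
        has_logderiv_pochhammer_lower has_logderiv_pochhammer_upper d_nonint)
  ultimately have "has_logderiv (\<lambda>s. num s / den s) (ln - ld) ?z"
    by (rule has_logderiv_divide)
  then have D: "((\<lambda>s. num s / den s) has_field_derivative num ?z / den ?z * (ln - ld)) (at ?z)"
    by (simp add: has_logderiv_def)
  have den0: "den ?z \<noteq> 0" using den by (simp add: has_logderiv_def)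
  have res: "residue (ratfun (k + r)) ?z = num ?z / den ?z * (ln - ld)"
    unfolding eq by (rule residue_double_quotient[OF hol den0 D])
  have lnld: "ln - ld = cot_diff - brace k + remainder r"
    unfolding ln_def ld_def l_def cot_diff_def brace_def remainder_def
    by (simp add: sum_list_addf sum_list_subtractf sum_list_const_mult algebra_simps)
  have num: "num ?z = ((-1) ^ k) ^ length d * poch_vec c k * poch_vec (map (\<lambda>x. 1 - x) c) r
      * (of_nat r + 1) ^ Suc m"
    unfolding num_def
    by (subst prod_list_pochhammer_diff_split) (simp add: len minus_one_power_cancel add.commute)
  have "pochhammer (- of_nat m - ?z) (m + k) = (-1) ^ (m + k) * fact (m + k)"
    using pochhammer_same[of "m + k", where ?'a = complex] by simp
  then have dn: "den ?z = ((-1) ^ k) ^ length d * poch_vec d k * poch_vec (map (\<lambda>x. 1 - x) d) r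
      * ((-1) ^ k * fact k * fact r) * ((-1) ^ (m + k) * fact (m + k) * fact r)"
    unfolding den_def
    by (subst prod_list_pochhammer_diff_split)
      (simp add: pochhammer_same pochhammer_fact[symmetric])
  \<comment> \<open>The signs from the parameter lists cancel because \<open>length c\<close> and
    \<open>length d\<close> have the same parity; the two integer products leave
    \<open>(-1) ^ m\<close>.\<close>
  have "num ?z / den ?z = (-1) ^ m * coef k * weight r"
  proof -
    have cancel: "e * A * B * C / (e * D * E * (i * (F * G * H)))
        = inverse i * (A / (D * G * F)) * (B * C / (E * H))" if "e \<noteq> 0" for e A B C D E F G H i :: complex
      using that by (simp add: field_simps)
    have sgn: "(-1) ^ k * ((-1) ^ k :: complex) = 1" "(-1) ^ m * ((-1) ^ m :: complex) = 1"
      by (simp_all flip: power_mult_distrib)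
    have "(-1) ^ k * fact k * fact r * ((-1) ^ (m + k) * fact (m + k) * fact r)
       = (-1) ^ m * ((-1) ^ k * (-1) ^ k) * (fact k * fact (m + k) * fact r ^ 2 :: complex)"
      by (simp add: power_add power2_eq_square)
    also have "\<dots> = (-1) ^ m * (fact k * fact (m + k) * fact r ^ 2)"
      by (simp only: sgn mult_1_right)
    finally have dn': "den ?z = ((-1) ^ k) ^ length d * poch_vec d k * poch_vec (map (\<lambda>x. 1 - x) d) r
       * ((-1) ^ m * (fact k * fact (m + k) * fact r ^ 2))"
      unfolding dn by (simp only: mult.assoc)
    have "num ?z / den ?z = inverse ((-1) ^ m) * coef k * weight r"
      unfolding num dn' coef_def weight_def by (intro cancel) simp
    also have "inverse ((-1) ^ m) = ((-1) ^ m :: complex)"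
      using sgn(2) by (rule inverse_unique)
    finally show ?thesis .
  qed
  with res lnld show ?thesis by simp
qed

text \<open>Only the product starting at \<open>-m - s\<close> vanishes here, namely in its factor
  number \<open>m - 1 - j\<close>, so the pole is simple.\<close>

lemma residue_ratfun_neg:
  assumes j: "j < m"
  shows "residue (ratfun M) (- of_nat (Suc j)) = (-1) ^ m * ncoef j * weight (Suc j + M)"
proof -
  let ?z = "- of_nat (Suc j) :: complex"
  define i where "i = m - 1 - j"
  have m: "m = i + Suc j" using j by (simp add: i_def)
  define num where "num = (\<lambda>s. - prod_list (map (\<lambda>x. pochhammer (1 - x - s) M) c) *
     (of_nat (Suc M) - s) ^ Suc m)"
  define den where "den = (\<lambda>s. prod_list (map (\<lambda>x. pochhammer (1 - x - s) M) d) *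
     pochhammer (0 - s) (Suc M) * (pochhammer (- of_nat m - s) i * pochhammer (- of_nat j - s) (M + Suc j)))"
  have eq: "ratfun M = (\<lambda>s. num s / (den s * (s - ?z)))"
  proof
    fix s :: complex
    have "pochhammer (- of_nat m - s) (m + Suc M)
        = pochhammer (- of_nat m - s) i * pochhammer (- of_nat j - s) (M + Suc j) * (- (s - ?z))"
      using pochhammer_factor_out[of "- of_nat m" s i "M + Suc j"] by (simp add: m add_ac)
    then show "ratfun M s = num s / (den s * (s - ?z))"
      by (simp only: ratfun_def num_def den_def mult_minus_right mult_minus_left minus_divide_left
          divide_minus_right mult_ac)
  qed
  have hol: "num holomorphic_on UNIV" "den holomorphic_on UNIV"
    unfolding num_def den_def
    by (intro holomorphic_intros holomorphic_on_prod_list holomorphic_on_pochhammer_diff)+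
  \<comment> \<open>Completing the product by its first \<open>Suc j\<close> factors lets the same
    \<open>weight\<close> reappear, at \<open>Suc j + M\<close>.\<close>
  have param: "prod_list (map (\<lambda>x. pochhammer (1 - x - ?z) M) xs)
      = poch_vec (map (\<lambda>x. 1 - x) xs) (Suc j + M) / poch_vec (map (\<lambda>x. 1 - x) xs) (Suc j)"
    if "\<And>x. x \<in> set xs \<Longrightarrow> x \<notin> \<int>" for xs
  proof -
    have "pochhammer (1 - x - ?z) M = pochhammer (1 - x) (Suc j + M) / pochhammer (1 - x) (Suc j)"
      if "x \<notin> \<int>" for x
      using pochhammer_add_of_nat[of "1 - x" "Suc j" M]
        pochhammer_nonint_nonzero[OF one_minus_notin_Ints[OF that]] by simp
    with that have "map (\<lambda>x. pochhammer (1 - x - ?z) M) xs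
        = map (\<lambda>x. pochhammer (1 - x) (Suc j + M) / pochhammer (1 - x) (Suc j)) xs"
      by (intro map_cong) auto
    then show ?thesis by (simp only: prod_list_divide_distrib poch_vec_map)
  qed
  have "pochhammer (- of_nat m - ?z) i = (-1) ^ i * fact i"
    using pochhammer_same[of i, where ?'a = complex] by (simp add: m)
  moreover have "pochhammer (0 - ?z) (Suc M) = fact (j + Suc M) / fact j"
    by (simp only: diff_0 minus_minus pochhammer_of_nat_Suc)
  moreover have "pochhammer (- of_nat j - ?z) (M + Suc j) = fact (M + Suc j)"
    by (simp add: pochhammer_fact)
  ultimately have den: "den ?z = poch_vec (map (\<lambda>x. 1 - x) d) (Suc j + M) / poch_vec (map (\<lambda>x. 1 - x) d) (Suc j)
      * (fact (j + Suc M) / fact j) * ((-1) ^ i * fact i * fact (M + Suc j))"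
    unfolding den_def by (simp only: param[OF d_nonint] mult_ac)
  have num: "num ?z = - (poch_vec (map (\<lambda>x. 1 - x) c) (Suc j + M) / poch_vec (map (\<lambda>x. 1 - x) c) (Suc j))
      * (of_nat (Suc j + M) + 1) ^ Suc m"
    unfolding num_def by (simp only: param[OF c_nonint]) (simp add: add_ac)
  have den0: "den ?z \<noteq> 0"
    unfolding den by (simp add: poch_vec_one_minus_nonzero del: fact_Suc)
  have "residue (ratfun M) ?z = num ?z / den ?z"
    unfolding eq by (rule residue_simple_quotient[OF hol den0])
  also have "\<dots> = - inverse ((-1) ^ i) * ((-1) ^ j * ncoef j) * weight (Suc j + M)"
  proof -
    have "(-1) ^ j * ((-1) ^ j :: complex) = 1" by (simp flip: power_mult_distrib)
    then have e: "(-1) ^ j * ncoef j = fact j * poch_vec (map (\<lambda>x. 1 - x) d) (Suc j) /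
      (poch_vec (map (\<lambda>x. 1 - x) c) (Suc j) * fact i)"
      unfolding ncoef_def i_def[symmetric] by (simp add: mult.assoc[symmetric])
    have f: "fact (j + Suc M) = (fact (Suc j + M) :: complex)"
        "fact (M + Suc j) = (fact (Suc j + M) :: complex)" by (simp_all only: add_Suc_right add_Suc add.commute)
    show ?thesis
      unfolding num den e weight_def f using poch_vec_one_minus_nonzero
      by (simp add: field_simps power2_eq_square del: fact_Suc of_nat_Suc power_Suc)
  qed
  also have "\<dots> = (-1) ^ m * ncoef j * weight (Suc j + M)"
  proof -
    have "inverse ((-1) ^ i) = ((-1) ^ i :: complex)" by (simp add: power_inverse[symmetric])
    then have "- inverse ((-1) ^ i) * (-1) ^ j = ((-1) ^ m :: complex)"
      by (simp add: m power_add)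
    then show ?thesis by (simp add: mult.assoc[symmetric])
  qed
  finally show ?thesis .
qed

text \<open>The pole comes from factor number \<open>n\<close> of the product for
  \<open>d ! j\<close>, which has \<open>M\<close> factors; hence \<open>M = n + Suc r\<close>.
  Every other product is split by \<open>pochhammer_diff_split\<close>.\<close>

lemma residue_ratfun_d:
  assumes j: "j < length d"
  shows "residue (ratfun (n + Suc r)) (1 - d ! j + of_nat n) = - dcoef j n * dweight j (Suc r)"
proof -
  let ?\<delta> = "d ! j" and ?d = "remove_nth j d" and ?M = "n + Suc r"
  let ?z = "1 - ?\<delta> + of_nat n"
  have \<delta>: "?\<delta> \<notin> \<int>" using d_nth_nonint[OF j] .
  define num where "num = (\<lambda>s. - prod_list (map (\<lambda>x. pochhammer (1 - x - s) ?M) c) *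
     (of_nat (Suc ?M) - s) ^ Suc m)"
  define den where "den = (\<lambda>s. prod_list (map (\<lambda>x. pochhammer (1 - x - s) ?M) ?d) *
     (pochhammer (1 - ?\<delta> - s) n * pochhammer (?z + 1 - s) r) *
     pochhammer (0 - s) (Suc ?M) * pochhammer (- of_nat m - s) (m + Suc ?M))"
  have eq: "ratfun ?M = (\<lambda>s. num s / (den s * (s - ?z)))"
  proof
    fix s :: complex
    have "prod_list (map (\<lambda>x. pochhammer (1 - x - s) ?M) d)
        = pochhammer (1 - ?\<delta> - s) n * pochhammer (?z + 1 - s) r * (- (s - ?z))
          * prod_list (map (\<lambda>x. pochhammer (1 - x - s) ?M) ?d)"
      unfolding prod_list_remove_nth[OF j] using pochhammer_factor_out[of "1 - ?\<delta>" s n r] by simp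
    then show "ratfun ?M s = num s / (den s * (s - ?z))"
      by (simp only: ratfun_def num_def den_def mult_minus_right mult_minus_left minus_divide_left
          divide_minus_right mult_ac)
  qed
  have hol: "num holomorphic_on UNIV" "den holomorphic_on UNIV"
    unfolding num_def den_def
    by (intro holomorphic_intros holomorphic_on_prod_list holomorphic_on_pochhammer_diff)+
  have param: "prod_list (map (\<lambda>x. pochhammer (1 - x - ?z) ?M) xs)
      = ((-1) ^ n) ^ length xs * poch_vec (map (\<lambda>x. 1 + x - ?\<delta>) xs) n * poch_vec (map (\<lambda>x. ?\<delta> - x) xs) (Suc r)"
    for xs
    using prod_list_pochhammer_diff_split[of "\<lambda>x. ?\<delta> - x" n "Suc r" xs] by (simp add: algebra_simps)
  have "pochhammer (1 - ?\<delta> - ?z) n = (-1) ^ n * fact n"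
    using pochhammer_same[of n, where ?'a = complex] by simp
  moreover have "pochhammer (?z + 1 - ?z) r = fact r"
    by (simp add: pochhammer_fact)
  moreover have "pochhammer (0 - ?z) (Suc ?M)
      = (-1) ^ n * pochhammer (2 - ?\<delta>) n * pochhammer (?\<delta> - 1) (Suc (Suc r))"
    using pochhammer_diff_split[of "?\<delta> - 1" n "Suc (Suc r)"] by (simp add: algebra_simps)
  moreover have "pochhammer (- of_nat m - ?z) (m + Suc ?M)
      = (-1) ^ n * pochhammer (2 - ?\<delta> + of_nat m) n * pochhammer (?\<delta> - 1 - of_nat m) (m + Suc (Suc r))"
    using pochhammer_diff_split[of "?\<delta> - 1 - of_nat m" n "m + Suc (Suc r)"] by (simp add: algebra_simps)
  ultimately have den: "den ?z = ((-1) ^ n) ^ (length ?d + 3)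
      * (poch_vec ([2 - ?\<delta>, 2 - ?\<delta> + of_nat m] @ map (\<lambda>x. 1 + x - ?\<delta>) ?d) n * fact n)
      * (poch_vec (map (\<lambda>x. ?\<delta> - x) ?d) (Suc r) * fact r * pochhammer (?\<delta> - 1) (Suc (Suc r))
      * pochhammer (?\<delta> - 1 - of_nat m) (m + Suc (Suc r)))"
    unfolding den_def by (simp only: param) (simp add: poch_vec_def power_add eval_nat_numeral)
  have num: "num ?z = - (((-1) ^ n) ^ (length ?d + 3) * poch_vec (map (\<lambda>x. 1 + x - ?\<delta>) c) n
     * (poch_vec (map (\<lambda>x. ?\<delta> - x) c) (Suc r) * (of_nat (Suc r) + ?\<delta>) ^ Suc m))"
  proof -
    \<comment> \<open>This matches the sign exponent in \<open>den\<close>: one sign per entry of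
      \<open>?d\<close> and three from the remaining products.\<close>
    have "length c = length ?d + 3" using len length_remove_nth[OF j] j by simp
    moreover have "of_nat (Suc ?M) - ?z = of_nat (Suc r) + ?\<delta>" by simp
    ultimately show ?thesis unfolding num_def by (simp only: param) (simp add: mult_ac)
  qed
  have z: "?\<delta> - 1 - of_nat n \<notin> \<int>" "?\<delta> - 1 - of_nat m - of_nat n \<notin> \<int>"
    using \<delta> by (metis Ints_1 Ints_add Ints_of_nat diff_add_cancel)+
  have den0: "den ?z \<noteq> 0"
  proof -
    have "prod_list (map (\<lambda>x. pochhammer (1 - x - ?z) ?M) ?d) \<noteq> 0"
    proof -
      have "pochhammer (1 - x - ?z) ?M \<noteq> 0" if "x \<in> set ?d" for x
      proof (rule pochhammer_nonint_nonzero)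
        have "?\<delta> - x - of_nat n \<notin> \<int>"
          using d_nth_diff_nonint[OF j that] by (metis Ints_add Ints_of_nat diff_add_cancel)
        then show "1 - x - ?z \<notin> \<int>" by (simp add: algebra_simps)
      qed
      then show ?thesis by (auto simp: prod_list_zero_iff)
    qed
    moreover have "pochhammer (1 - ?\<delta> - ?z) n \<noteq> 0" "pochhammer (?z + 1 - ?z) r \<noteq> 0"
      using pochhammer_same[of n, where ?'a = complex] pochhammer_fact[of r, where ?'a = complex] by auto
    moreover have "pochhammer (0 - ?z) (Suc ?M) \<noteq> 0"
      using pochhammer_nonint_nonzero[OF z(1), of "Suc ?M"] by (simp add: algebra_simps)
    moreover have "pochhammer (- of_nat m - ?z) (m + Suc ?M) \<noteq> 0"
      using pochhammer_nonint_nonzero[OF z(2), of "m + Suc ?M"] by (simp add: algebra_simps)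
    ultimately show ?thesis unfolding den_def by simp
  qed
  have "residue (ratfun ?M) ?z = num ?z / den ?z"
    unfolding eq by (rule residue_simple_quotient[OF hol den0])
  also have "\<dots> = - dcoef j n * dweight j (Suc r)"
    unfolding num den dcoef_def dweight_def
    by (simp add: field_simps del: of_nat_Suc append.simps power_Suc)
  finally show ?thesis .
qed

section \<open>Growth rates of weights and coefficients\<close>

definition exponent :: complex where
  "exponent = of_nat (Suc m) + sum_list d - sum_list c"

definition weight_lim :: complex where
  "weight_lim = prod_list (map rGamma (map (\<lambda>x. 1 - x) c)) / prod_list (map rGamma (map (\<lambda>x. 1 - x) d))"

definition dweight_lim :: "nat \<Rightarrow> complex" where
  "dweight_lim j = prod_list (map rGamma (map (\<lambda>x. d ! j - x) c)) /
    (prod_list (map rGamma (map (\<lambda>x. d ! j - x) (remove_nth j d))) * ((d ! j - 1) * rGamma (d ! j)) *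
     (pochhammer (d ! j - 1 - of_nat m) (Suc m) * rGamma (d ! j)))"

lemma has_growth_weight: "has_growth weight exponent weight_lim"
proof -
  let ?c = "map (\<lambda>x. 1 - x) c" and ?d = "map (\<lambda>x. 1 - x) d"
  have d0: "prod_list (map rGamma ?d) \<noteq> 0"
    using d_nonint one_minus_notin_Ints by (intro prod_list_rGamma_nonzero) auto
  have "weight = (\<lambda>r. poch_vec ?c r / fact r ^ length ?c / (poch_vec ?d r / fact r ^ length ?d) * (of_nat r + 1) ^ Suc m)"
  proof -
    have "A * P / (B * fact r ^ 2) = A / fact r ^ (l + 2) / (B / fact r ^ l) * P" for A B P :: complex and l r
       by (simp add: field_simps power2_eq_square)
    then show ?thesis unfolding weight_def fun_eq_iff length_map len by blast
  qed
  moreover have "has_growth \<dots> (sum_list ?c - of_nat (length ?c) - (sum_list ?d - of_nat (length ?d)) + of_nat (Suc m) * 1)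
     (prod_list (map rGamma ?c) / prod_list (map rGamma ?d) * 1 ^ Suc m)"
    by (intro has_growth_mult has_growth_divide has_growth_poch_vec has_growth_power has_growth_linear d0)
  ultimately show ?thesis
    by (simp add: exponent_def weight_lim_def sum_list_const_diff algebra_simps del: of_nat_Suc)
qed

text \<open>The rate \<open>- 1 - exponent\<close> gives absolute summability exactly when
  \<open>Re exponent > 0\<close>.\<close>

lemma has_growth_coef: "\<exists>L. has_growth coef (- 1 - exponent) L"
proof -
  have d0: "prod_list (map rGamma d) \<noteq> 0"
    using d_nonint by (intro prod_list_rGamma_nonzero) auto
  have m0: "rGamma (1 + of_nat m) \<noteq> (0 :: complex)"
    by (metis of_nat_Suc rGamma_eq_zero_iff of_nat_in_nonpos_Ints_iff nat.distinct(1))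
  have f: "fact (m + k) = (fact m * pochhammer (1 + of_nat m) k :: complex)" for k
    using pochhammer_product'[of "1 :: complex" m k] by (simp add: pochhammer_fact[symmetric])
  have "coef = (\<lambda>r. poch_vec c r / fact r ^ length c / ((poch_vec d r / fact r ^ length d)
      * (pochhammer (1 + of_nat m) r / fact r) * fact m))"
  proof -
    have "A / (B * (D * P) * F) = A / F ^ (l + 2) / (B / F ^ l * (P / F) * D)" if "F \<noteq> 0"
      for A B D F P :: complex and l
      using that by (simp add: field_simps power2_eq_square)
    then show ?thesis unfolding coef_def fun_eq_iff len f by simp
  qed
  moreover have "has_growth \<dots> (sum_list c - of_nat (length c) - (sum_list d - of_nat (length d) + (1 + of_nat m - 1) + 0))
     (prod_list (map rGamma c) / (prod_list (map rGamma d) * rGamma (1 + of_nat m) * fact m))"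
    by (intro has_growth_mult has_growth_divide has_growth_poch_vec has_growth_pochhammer has_growth_const)
      (use d0 m0 in simp)
  ultimately have "has_growth coef (- 1 - exponent)
      (prod_list (map rGamma c) / (prod_list (map rGamma d) * rGamma (1 + of_nat m) * fact m))"
    by (simp add: exponent_def len algebra_simps)
  then show ?thesis ..
qed

text \<open>The shifts by \<open>d ! j\<close> cancel between the two parameter rows, so the rate is
  that of \<open>coef\<close> for every \<open>j\<close>.\<close>

lemma has_growth_dcoef:
  assumes j: "j < length d"
  shows "\<exists>L. has_growth (dcoef j) (- 1 - exponent) L"
proof -
  let ?\<delta> = "d ! j" and ?d = "remove_nth j d"
  let ?b = "map (\<lambda>x. 1 + x - ?\<delta>) ?d" and ?a = "map (\<lambda>x. 1 + x - ?\<delta>) c"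
  define bs where "bs = [2 - ?\<delta>, 2 - ?\<delta> + of_nat m] @ ?b"
  have ld: "length ?d = length d - 1" using length_remove_nth[OF j] .
  have lbs: "length c = length bs + 1" using len ld j by (simp add: bs_def)
  have sd: "sum_list d = ?\<delta> + sum_list ?d"
    using sum_list_remove_nth[OF j, of "\<lambda>x. x"] by simp
  have sa: "sum_list (map (\<lambda>x. 1 + x - ?\<delta>) xs) = sum_list xs - of_nat (length xs) * (?\<delta> - 1)" for xs
    using sum_list_diff_const[of "?\<delta> - 1" xs] by (simp add: algebra_simps)
  have "2 - ?\<delta> \<notin> \<int>" using d_nth_nonint[OF j] by (metis Ints_diff Ints_numeral diff_diff_eq2 add_diff_cancel_left')
  moreover from this have "2 - ?\<delta> + of_nat m \<notin> \<int>" by (metis Ints_diff Ints_of_nat add_diff_cancel_right')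
  moreover have "1 + x - ?\<delta> \<notin> \<int>" if "x \<in> set ?d" for x
    using one_minus_notin_Ints[OF d_nth_diff_nonint[OF j that]] by (simp add: algebra_simps)
  ultimately have b0: "prod_list (map rGamma bs) \<noteq> 0"
    by (intro prod_list_rGamma_nonzero) (auto simp: bs_def)
  have "dcoef j = (\<lambda>r. poch_vec ?a r / fact r ^ length ?a / (poch_vec bs r / fact r ^ length bs))"
    unfolding dcoef_def bs_def[symmetric] fun_eq_iff length_map lbs by (simp add: field_simps)
  moreover have "has_growth \<dots> (sum_list ?a - of_nat (length ?a) - (sum_list bs - of_nat (length bs)))
     (prod_list (map rGamma ?a) / prod_list (map rGamma bs))"
    by (intro has_growth_divide has_growth_poch_vec b0)
  moreover have "sum_list ?a - of_nat (length ?a) - (sum_list bs - of_nat (length bs)) = - 1 - exponent"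
  proof -
    have l: "(of_nat (length d) :: complex) = of_nat (length ?d) + 1"
      using ld j by (metis Suc_pred' length_greater_0_conv list.size(3) not_less_zero of_nat_Suc add.commute)
    show ?thesis
      unfolding exponent_def bs_def sa sum_list_append sd length_map len
      by (simp add: sa l algebra_simps)
  qed
  ultimately show ?thesis by auto
qed

text \<open>The rate agrees with that of \<open>weight\<close>, so a single power of
  \<open>Suc M\<close> normalises all residue families.\<close>

lemma has_growth_dweight:
  assumes j: "j < length d"
  shows "has_growth (dweight j) exponent (dweight_lim j)"
proof -
  let ?\<delta> = "d ! j" and ?d = "remove_nth j d"
  let ?b = "map (\<lambda>x. ?\<delta> - x) ?d" and ?a = "map (\<lambda>x. ?\<delta> - x) c"
  have \<delta>: "?\<delta> \<notin> \<int>" using d_nth_nonint[OF j] .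
  have l: "length d = length ?d + 1" using length_remove_nth[OF j] j by simp
  have sd: "sum_list d = ?\<delta> + sum_list ?d"
    using sum_list_remove_nth[OF j, of "\<lambda>x. x"] by simp
  have b0: "prod_list (map rGamma ?b) \<noteq> 0"
    using d_nth_diff_nonint[OF j] by (intro prod_list_rGamma_nonzero) auto
  have \<delta>0: "rGamma ?\<delta> \<noteq> 0" "?\<delta> - 1 \<noteq> 0"
    using \<delta> nonpos_Ints_subset_Ints by (auto simp: rGamma_eq_zero_iff)
  have p0: "pochhammer (?\<delta> - 1 - of_nat m) (Suc m) \<noteq> 0"
    using \<delta> by (intro pochhammer_nonint_nonzero) (metis Ints_1 Ints_add Ints_of_nat diff_add_cancel)
  \<comment> \<open>Splitting off the first factors, fixed in number, leaves
    \<open>pochhammer ?\<delta> r\<close> in both products.\<close>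
  have e1: "pochhammer (?\<delta> - 1) (Suc r) = (?\<delta> - 1) * pochhammer ?\<delta> r" for r
    by (simp add: pochhammer_rec)
  have e2: "pochhammer (?\<delta> - 1 - of_nat m) (m + Suc r)
      = pochhammer (?\<delta> - 1 - of_nat m) (Suc m) * pochhammer ?\<delta> r" for r
    using pochhammer_product'[of "?\<delta> - 1 - of_nat m" "Suc m" r] by simp
  have "dweight j = (\<lambda>r. poch_vec ?a r / fact r ^ length ?a * (of_nat r + ?\<delta>) ^ Suc m * (of_nat r + 0) /
     (poch_vec ?b r / fact r ^ length ?b * ((?\<delta> - 1) * (pochhammer ?\<delta> r / fact r)) *
      (pochhammer (?\<delta> - 1 - of_nat m) (Suc m) * (pochhammer ?\<delta> r / fact r))))"
  proof -
    have "A * P * R / (B * F * (x * y) * (z * y)) = A / F ^ (l + 1 + 2) * P * (R + 0) / (B / F ^ l * (x * (y / F)) * (z * (y / F)))"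
      if "F \<noteq> 0" for A B F P R x y z :: complex and l
      using that by (simp add: field_simps power2_eq_square)
    then show ?thesis unfolding dweight_def e1 e2 length_map len l fun_eq_iff by simp
  qed
  moreover have "has_growth \<dots>
     (sum_list ?a - of_nat (length ?a) + of_nat (Suc m) * 1 + 1 -
       (sum_list ?b - of_nat (length ?b) + (0 + (?\<delta> - 1)) + (0 + (?\<delta> - 1))))
     (prod_list (map rGamma ?a) * 1 ^ Suc m * 1 / (prod_list (map rGamma ?b) * ((?\<delta> - 1) * rGamma ?\<delta>) *
      (pochhammer (?\<delta> - 1 - of_nat m) (Suc m) * rGamma ?\<delta>)))"
    by (intro has_growth_divide has_growth_mult has_growth_poch_vec has_growth_power has_growth_linear
        has_growth_pochhammer has_growth_const) (use b0 \<delta>0 p0 in simp)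
  moreover have "sum_list ?a - of_nat (length ?a) + of_nat (Suc m) * 1 + 1 -
       (sum_list ?b - of_nat (length ?b) + (0 + (?\<delta> - 1)) + (0 + (?\<delta> - 1))) = exponent"
    unfolding exponent_def sd sum_list_const_diff length_map len l by (simp add: algebra_simps)
  ultimately show ?thesis by (simp add: dweight_lim_def)
qed

text \<open>There are \<open>length d + 2\<close> positive and \<open>length c\<close> negative
  digammas, so the logarithms cancel by \<open>len\<close>.\<close>

lemma brace_tendsto_0: "brace \<longlonglongrightarrow> 0"
proof -
  have "1 \<notin> (\<int>\<^sub>\<le>\<^sub>0 :: complex set)" "1 + of_nat m \<notin> (\<int>\<^sub>\<le>\<^sub>0 :: complex set)"
    by (simp, metis of_nat_Suc of_nat_in_nonpos_Ints_iff nat.distinct(1))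
  moreover have "x \<notin> \<int>\<^sub>\<le>\<^sub>0" if "x \<in> set c \<or> x \<in> set d" for x
    using that c_nonint d_nonint nonpos_Ints_subset_Ints by auto
  ultimately have "(\<lambda>n. (sum_list (map (\<lambda>x. Digamma (x + of_nat n)) d) - of_nat (length d) * of_real (ln (real n)))
     + (Digamma (1 + of_nat n) - of_real (ln (real n)))
     + (Digamma (1 + of_nat m + of_nat n) - of_real (ln (real n)))
     - (sum_list (map (\<lambda>x. Digamma (x + of_nat n)) c) - of_nat (length c) * of_real (ln (real n))))
     \<longlonglongrightarrow> 0 + 0 + 0 - 0"
    by (intro tendsto_add tendsto_diff sum_list_Digamma_shift_asymp Digamma_shift_asymp) auto
  then show ?thesis
    by (simp add: brace_def[abs_def] len algebra_simps)
qed

lemma remainder_tendsto_0: "remainder \<longlonglongrightarrow> 0"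
proof -
  have one: "1 \<notin> (\<int>\<^sub>\<le>\<^sub>0 :: complex set)" by simp
  have nonpos: "1 - x \<notin> \<int>\<^sub>\<le>\<^sub>0" if "x \<in> set c \<or> x \<in> set d" for x
    using that c_nonint d_nonint one_minus_notin_Ints nonpos_Ints_subset_Ints by blast
  have lim: "(\<lambda>n. sum_list (map (\<lambda>x. Digamma (x + of_nat n)) (map (\<lambda>x. 1 - x) xs))
      - of_nat (length (map (\<lambda>x. 1 - x) xs)) * of_real (ln (real n))) \<longlonglongrightarrow> 0"
    if "set xs \<subseteq> set c \<union> set d" for xs
    by (rule sum_list_Digamma_shift_asymp) (use that nonpos in auto)
  have "(\<lambda>n. of_nat (Suc m) * inverse (of_nat (Suc n)) :: complex) \<longlonglongrightarrow> of_nat (Suc m) * 0"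
    by (intro tendsto_mult tendsto_const LIMSEQ_Suc[OF lim_inverse_n])
  then have inv: "(\<lambda>n. of_nat (Suc m) / (of_nat n + 1) :: complex) \<longlonglongrightarrow> 0"
    by (simp add: divide_inverse add.commute)
  have "(\<lambda>n. (sum_list (map (\<lambda>x. Digamma (x + of_nat n)) (map (\<lambda>x. 1 - x) d))
      - of_nat (length (map (\<lambda>x. 1 - x) d)) * of_real (ln (real n)))
     + 2 * (Digamma (1 + of_nat n) - of_real (ln (real n)))
     - (sum_list (map (\<lambda>x. Digamma (x + of_nat n)) (map (\<lambda>x. 1 - x) c))
      - of_nat (length (map (\<lambda>x. 1 - x) c)) * of_real (ln (real n)))
     - of_nat (Suc m) / (of_nat n + 1)) \<longlonglongrightarrow> 0 + 2 * 0 - 0 - 0"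
    by (intro tendsto_add tendsto_diff tendsto_mult tendsto_const lim inv Digamma_shift_asymp one) auto
  then show ?thesis
    by (simp add: remainder_def[abs_def] len o_def algebra_simps)
qed

section \<open>Pole sets and the residue sum for finite \<open>M\<close>\<close>

definition nat_poles :: "nat \<Rightarrow> complex set" where
  "nat_poles M = of_nat ` {..M}"

definition neg_poles :: "complex set" where
  "neg_poles = (\<lambda>j. - of_nat (Suc j)) ` {..<m}"

definition d_poles :: "nat \<Rightarrow> complex set" where
  "d_poles M = (\<lambda>(j, n). 1 - d ! j + of_nat n) ` ({..<length d} \<times> {..<M})"

lemma ratfun_holomorphic: "ratfun M holomorphic_on - (nat_poles M \<union> neg_poles \<union> d_poles M)"
proof -
  have "prod_list (map (\<lambda>x. pochhammer (1 - x - s) M) d) \<noteq> 0" if s: "s \<notin> d_poles M" for s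
  proof
    assume "prod_list (map (\<lambda>x. pochhammer (1 - x - s) M) d) = 0"
    then obtain x where "x \<in> set d" "pochhammer (1 - x - s) M = 0" by (auto simp: prod_list_zero_iff)
    then obtain j n where "j < length d" "n < M" "1 - d ! j - s = - of_nat n"
      unfolding pochhammer_eq_0_iff by (metis in_set_conv_nth)
    then have "s = 1 - d ! j + of_nat n" "(j, n) \<in> {..<length d} \<times> {..<M}"
      by (auto simp: algebra_simps)
    with s show False unfolding d_poles_def by (metis (mono_tags, lifting) case_prod_conv image_eqI)
  qed
  moreover have "pochhammer (0 - s) (Suc M) \<noteq> 0" if "s \<notin> nat_poles M" for s
    using that unfolding pochhammer_eq_0_iff nat_poles_def by auto
  moreover have "pochhammer (- of_nat m - s) (m + Suc M) \<noteq> 0"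
    if s: "s \<notin> nat_poles M" "s \<notin> neg_poles" for s
  proof
    assume "pochhammer (- of_nat m - s) (m + Suc M) = 0"
    then obtain k where k: "k < m + Suc M" "- of_nat m - s = - of_nat k"
      unfolding pochhammer_eq_0_iff by blast
    then have s': "s = of_nat k - of_nat m" by (simp add: algebra_simps)
    show False
    proof (cases "m \<le> k")
      case True
      then have "s = of_nat (k - m)" "k - m \<le> M" using s' k by (auto simp: of_nat_diff)
      with s(1) show False by (auto simp: nat_poles_def)
    next
      case False
      then have "s = - of_nat (m - k)" using s' by (simp add: of_nat_diff)
      then have "s = - of_nat (Suc (m - 1 - k))" "m - 1 - k < m" using False
        by (simp_all add: Suc_diff_Suc flip: of_nat_Suc)
      with s(2) show False unfolding neg_poles_def by blast
    qed
  qed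
  ultimately show ?thesis
    unfolding ratfun_def
    by (intro holomorphic_intros holomorphic_on_prod_list holomorphic_on_pochhammer_diff) auto
qed

lemma ratfun_at_infinity: "((\<lambda>s. s * ratfun M s) \<longlongrightarrow> -1) at_infinity"
proof -
  let ?P = "\<lambda>xs s. prod_list (map (\<lambda>x. pochhammer (1 - x - s) M / s ^ M) xs)"
  have "((\<lambda>s. ?P c s * (pochhammer (of_nat (Suc M) - s) 1 / s ^ 1) ^ Suc m /
     (?P d s * (pochhammer (0 - s) (Suc M) / s ^ Suc M) *
      (pochhammer (- of_nat m - s) (m + Suc M) / s ^ (m + Suc M))))
    \<longlongrightarrow> prod_list (map (\<lambda>x. (-1) ^ M) c) * ((-1) ^ 1) ^ Suc m /
     (prod_list (map (\<lambda>x. (-1) ^ M) d) * (-1) ^ Suc M * (-1) ^ (m + Suc M))) at_infinity"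
    by (intro tendsto_intros tendsto_prod_list tendsto_pochhammer_diff_over_power)
      (auto simp: prod_list_zero_iff)
  moreover have "prod_list (map (\<lambda>x. (-1) ^ M) c) * ((-1) ^ 1) ^ Suc m /
     (prod_list (map (\<lambda>x. (-1) ^ M) d) * (-1) ^ Suc M * (-1) ^ (m + Suc M)) = (-1 :: complex)"
    by (simp add: prod_list_const len power_add)
  moreover have "eventually (\<lambda>s. ?P c s * (pochhammer (of_nat (Suc M) - s) 1 / s ^ 1) ^ Suc m /
     (?P d s * (pochhammer (0 - s) (Suc M) / s ^ Suc M) *
      (pochhammer (- of_nat m - s) (m + Suc M) / s ^ (m + Suc M))) = s * ratfun M s) at_infinity"
    using eventually_not_equal_at_infinity[of 0]
  proof eventually_elim
    case (elim s)
    have "A / (s ^ M) ^ (l + 2) * (B / s) ^ Suc m / (D / (s ^ M) ^ l * (E / s ^ Suc M) * (F / s ^ (m + Suc M)))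
      = s * (A * B ^ Suc m / (D * E * F))" for A B D E F and l
    proof -
      \<comment> \<open>The degree count: both sides have exponent
        \<open>M * (l + 2) + m + 2\<close>.\<close>
      have "s * (s ^ M) ^ (l + 2) * s ^ Suc m = (s ^ M) ^ l * s ^ Suc M * s ^ (m + Suc M)"
        by (simp add: power_add power2_eq_square)
      then show ?thesis using elim
        by (simp add: power_divide divide_simps del: power_Suc) (simp add: mult_ac del: power_Suc)
    qed
    then show ?case
      unfolding ratfun_def prod_list_divide_distrib prod_list_const len power_one_right pochhammer_1 .
  qed
  ultimately show ?thesis by (simp only: Lim_transform_eventually)
qed

lemma d_pole_nonint:
  assumes "j < length d" shows "1 - d ! j + of_nat n \<notin> \<int>"
  using one_minus_notin_Ints[OF d_nth_nonint[OF assms]] by (metis Ints_diff Ints_of_nat add_diff_cancel_right')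

text \<open>A collision would make a difference of two entries of \<open>d\<close> an
  integer.\<close>

lemma inj_on_d_poles: "inj_on (\<lambda>(j, n). 1 - d ! j + of_nat n) ({..<length d} \<times> {..<M})"
proof (rule inj_onI, clarsimp)
  fix j n j' n' assume *: "j < length d" "j' < length d" "of_nat n - d ! j = of_nat n' - d ! j'"
  then have "d ! j - d ! j' = of_nat n - of_nat n'" by (simp add: algebra_simps)
  then have "d ! j - d ! j' \<in> \<int>" by simp
  with d_distinct * have "j = j'" by blast
  with * show "j = j' \<and> n = n'" by simp
qed

text \<open>All residues of \<open>ratfun M\<close> sum to \<open>-1\<close>. The three pole sets
  are disjoint: the \<open>d\<close>-poles are not integers, and the other two are separated by
  sign.\<close>

lemma truncated_identity:
  "(-1) ^ m * (\<Sum>k\<le>M. coef k * (cot_diff - brace k) * weight (M - k))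
     + (-1) ^ m * (\<Sum>k\<le>M. coef k * (weight (M - k) * remainder (M - k)))
     + (-1) ^ m * (\<Sum>j<m. ncoef j * weight (Suc j + M))
     - (\<Sum>j<length d. \<Sum>n\<le>M. dcoef j n * dweight j (M - n)) = -1"
proof -
  have fin: "finite (nat_poles M)" "finite neg_poles" "finite (d_poles M)"
    by (auto simp: nat_poles_def neg_poles_def d_poles_def)
  have neg_nat: "nat_poles M \<inter> neg_poles = {}"
  proof -
    have "of_nat k \<noteq> (- of_nat (Suc j) :: complex)" for k j
    proof
      assume "of_nat k = (- of_nat (Suc j) :: complex)"
      then have "of_nat (k + Suc j) = (0 :: complex)" by (simp only: of_nat_add add_eq_0_iff2)
      then show False by (simp only: of_nat_eq_0_iff)
    qed
    then show ?thesis by (auto simp: nat_poles_def neg_poles_def simp del: of_nat_Suc)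
  qed
  have "nat_poles M \<union> neg_poles \<subseteq> \<int>"
    by (auto simp: nat_poles_def neg_poles_def simp del: of_nat_Suc)
  moreover have "d_poles M \<inter> \<int> = {}"
    using d_pole_nonint by (auto simp: d_poles_def)
  ultimately have d_disj: "(nat_poles M \<union> neg_poles) \<inter> d_poles M = {}" by blast
  have "(\<Sum>p\<in>nat_poles M \<union> neg_poles \<union> d_poles M. residue (ratfun M) p) = -1"
    by (rule sum_residues_eq_limit) (use fin ratfun_holomorphic ratfun_at_infinity in auto)
  also have "(\<Sum>p\<in>nat_poles M \<union> neg_poles \<union> d_poles M. residue (ratfun M) p)
     = (\<Sum>p\<in>nat_poles M. residue (ratfun M) p) + (\<Sum>p\<in>neg_poles. residue (ratfun M) p)
      + (\<Sum>p\<in>d_poles M. residue (ratfun M) p)"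
    using fin neg_nat d_disj by (simp add: sum.union_disjoint)
  also have "(\<Sum>p\<in>nat_poles M. residue (ratfun M) p)
      = (\<Sum>k\<le>M. (-1) ^ m * coef k * weight (M - k) * (cot_diff - brace k + remainder (M - k)))"
    unfolding nat_poles_def
  proof (subst sum.reindex)
    show "(\<Sum>k\<le>M. (residue (ratfun M) \<circ> of_nat) k)
      = (\<Sum>k\<le>M. (-1) ^ m * coef k * weight (M - k) * (cot_diff - brace k + remainder (M - k)))"
    proof (rule sum.cong)
      fix k assume "k \<in> {..M}"
      then show "(residue (ratfun M) \<circ> of_nat) k
        = (-1) ^ m * coef k * weight (M - k) * (cot_diff - brace k + remainder (M - k))"
        using residue_ratfun_nat[of k "M - k"] by simp
    qed auto
  qed (auto intro: inj_onI)
  also have "(\<Sum>p\<in>neg_poles. residue (ratfun M) p) = (\<Sum>j<m. (-1) ^ m * ncoef j * weight (Suc j + M))"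
    unfolding neg_poles_def
    by (subst sum.reindex) (auto simp: residue_ratfun_neg intro!: inj_onI sum.cong simp del: of_nat_Suc)
  also have "(\<Sum>p\<in>d_poles M. residue (ratfun M) p)
      = (\<Sum>(j, n)\<in>{..<length d} \<times> {..<M}. - dcoef j n * dweight j (M - n))"
    unfolding d_poles_def
  proof (subst sum.reindex[OF inj_on_d_poles], rule sum.cong)
    fix p assume p: "p \<in> {..<length d} \<times> {..<M}"
    then obtain j n where jn: "p = (j, n)" "j < length d" "n < M" by auto
    then have "M = n + Suc (M - Suc n)" "M - n = Suc (M - Suc n)" by auto
    then have "residue (ratfun M) (1 - d ! j + of_nat n) = - dcoef j n * dweight j (M - n)"
      using residue_ratfun_d[OF jn(2), of n "M - Suc n"] by metis
    then show "(residue (ratfun M) \<circ> (\<lambda>(j, n). 1 - d ! j + of_nat n)) p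
        = (case p of (j, n) \<Rightarrow> - dcoef j n * dweight j (M - n))"
      using jn by simp
  qed auto
  also have "\<dots> = (\<Sum>j<length d. \<Sum>n<M. - dcoef j n * dweight j (M - n))"
    by (simp add: sum.cartesian_product)
  also have "\<dots> = - (\<Sum>j<length d. \<Sum>n\<le>M. dcoef j n * dweight j (M - n))"
  proof -
    \<comment> \<open>This adds the vanishing term \<open>n = M\<close>, giving the range that
      \<open>has_growth_convolution\<close> expects.\<close>
    have "dweight j 0 = 0" for j by (simp add: dweight_def)
    then show ?thesis by (simp add: sum_negf flip: lessThan_Suc_atMost)
  qed
  finally show ?thesis
    by (simp add: sum_distrib_left sum.distrib[symmetric] algebra_simps)
qed

text \<open>Divide \<open>truncated_identity\<close> by \<open>of_nat (Suc M) powr exponent\<close>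
  and take the limit of each family separately.\<close>

lemma limit_identity:
  assumes re: "Re exponent > 0"
  shows "weight_lim * (\<Sum>k. coef k * (cot_diff - brace k)) + weight_lim * (\<Sum>j<m. ncoef j)
     = (-1) ^ m * (\<Sum>j<length d. dweight_lim j * (\<Sum>n. dcoef j n))"
proof -
  obtain L where L: "has_growth coef (- 1 - exponent) L" using has_growth_coef by blast
  have sum_coef: "summable (\<lambda>k. norm (coef k))"
    by (rule has_growth_summable[OF L]) (use re in simp)
  have "has_growth (\<lambda>k. cot_diff - brace k) 0 (cot_diff - 0)"
    unfolding has_growth_tendsto_0 by (intro tendsto_diff tendsto_const brace_tendsto_0)
  from has_growth_mult[OF L this]
  have sum_brace: "summable (\<lambda>k. norm (coef k * (cot_diff - brace k)))"
    by (rule has_growth_summable) (use re in simp)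
  \<comment> \<open>Since \<open>remainder\<close> tends to 0, the product with
    \<open>weight\<close> is a weight with limit 0, and its convolution with \<open>coef\<close>
    drops out.\<close>
  have "has_growth remainder 0 0"
    unfolding has_growth_tendsto_0 by (rule remainder_tendsto_0)
  from has_growth_mult[OF has_growth_weight this]
  have wr: "has_growth (\<lambda>r. weight r * remainder r) exponent 0" by simp
  have l1: "(\<lambda>M. (\<Sum>k\<le>M. coef k * (cot_diff - brace k) * weight (M - k)) / of_nat (Suc M) powr exponent)
      \<longlonglongrightarrow> weight_lim * (\<Sum>k. coef k * (cot_diff - brace k))"
    by (rule has_growth_convolution[OF has_growth_weight _ sum_brace]) (use re in simp)
  have l2: "(\<lambda>M. (\<Sum>k\<le>M. coef k * (weight (M - k) * remainder (M - k))) / of_nat (Suc M) powr exponent)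
      \<longlonglongrightarrow> 0 * suminf coef"
    by (rule has_growth_convolution[OF wr _ sum_coef]) (use re in simp)
  have l3: "(\<lambda>M. \<Sum>j<m. ncoef j * (weight (Suc j + M) / of_nat (Suc M) powr exponent))
      \<longlonglongrightarrow> (\<Sum>j<m. ncoef j * weight_lim)"
    by (rule tendsto_sum, rule tendsto_mult[OF tendsto_const], rule has_growth_shift, rule has_growth_weight)
  have l4: "(\<lambda>M. \<Sum>j<length d. (\<Sum>n\<le>M. dcoef j n * dweight j (M - n)) / of_nat (Suc M) powr exponent)
      \<longlonglongrightarrow> (\<Sum>j<length d. dweight_lim j * (\<Sum>n. dcoef j n))"
  proof (rule tendsto_sum)
    fix j assume "j \<in> {..<length d}"
    then have j: "j < length d" by simp
    obtain K where "has_growth (dcoef j) (- 1 - exponent) K" using has_growth_dcoef[OF j] by blast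
    then have "summable (\<lambda>n. norm (dcoef j n))"
      by (rule has_growth_summable) (use re in simp)
    then show "(\<lambda>M. (\<Sum>n\<le>M. dcoef j n * dweight j (M - n)) / of_nat (Suc M) powr exponent)
        \<longlonglongrightarrow> dweight_lim j * (\<Sum>n. dcoef j n)"
      by (rule has_growth_convolution[OF has_growth_dweight[OF j], rotated]) (use re in simp)
  qed
  note tendsto_diff[OF tendsto_add[OF tendsto_add[OF tendsto_mult[OF tendsto_const[of "(-1) ^ m"] l1]
    tendsto_mult[OF tendsto_const[of "(-1) ^ m"] l2]] tendsto_mult[OF tendsto_const[of "(-1) ^ m"] l3]] l4]
  moreover have "(-1) ^ m * ((\<Sum>k\<le>M. coef k * (cot_diff - brace k) * weight (M - k)) / of_nat (Suc M) powr exponent)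
     + (-1) ^ m * ((\<Sum>k\<le>M. coef k * (weight (M - k) * remainder (M - k))) / of_nat (Suc M) powr exponent)
     + (-1) ^ m * (\<Sum>j<m. ncoef j * (weight (Suc j + M) / of_nat (Suc M) powr exponent))
     - (\<Sum>j<length d. (\<Sum>n\<le>M. dcoef j n * dweight j (M - n)) / of_nat (Suc M) powr exponent)
     = -1 / of_nat (Suc M) powr exponent" for M
    \<comment> \<open>The first three occurrences of \<open>-1\<close> are the bases of
      \<open>(-1) ^ m\<close>; the fourth is the numerator to be replaced.\<close>
    by (subst (4) truncated_identity[of M, symmetric])
      (simp add: add_divide_distrib diff_divide_distrib sum_divide_distrib sum_distrib_left mult.assoc del: of_nat_Suc)
  ultimately have "(\<lambda>M. -1 / of_nat (Suc M) powr exponent)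
    \<longlonglongrightarrow> (-1) ^ m * (weight_lim * (\<Sum>k. coef k * (cot_diff - brace k)))
     + (-1) ^ m * (0 * suminf coef)
     + (-1) ^ m * (\<Sum>j<m. ncoef j * weight_lim)
     - (\<Sum>j<length d. dweight_lim j * (\<Sum>n. dcoef j n))"
    by (simp only:)
  from LIMSEQ_unique[OF this inverse_powr_tendsto_0[OF re]]
  have "(-1) ^ m * (weight_lim * (\<Sum>k. coef k * (cot_diff - brace k)) + weight_lim * (\<Sum>j<m. ncoef j))
     = (\<Sum>j<length d. dweight_lim j * (\<Sum>n. dcoef j n))"
    by (simp add: sum_distrib_left algebra_simps)
  \<comment> \<open>A second factor \<open>(-1) ^ m\<close> moves the sign to the other side, as its
    square is 1.\<close>
  then have "(-1) ^ m * ((-1) ^ m * (weight_lim * (\<Sum>k. coef k * (cot_diff - brace k)) + weight_lim * (\<Sum>j<m. ncoef j)))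
     = (-1) ^ m * (\<Sum>j<length d. dweight_lim j * (\<Sum>n. dcoef j n))"
    by (simp only:)
  then show ?thesis
    by (simp only: mult.assoc[symmetric] power_mult_distrib[symmetric]) simp
qed

section \<open>Closed forms of the limits and the resulting series\<close>

lemma weight_lim_eq:
  "weight_lim = Gamma_vec (map (\<lambda>x. 1 - x) d) / Gamma_vec (map (\<lambda>x. 1 - x) c)" "weight_lim \<noteq> 0"
proof -
  show "weight_lim = Gamma_vec (map (\<lambda>x. 1 - x) d) / Gamma_vec (map (\<lambda>x. 1 - x) c)"
    unfolding weight_lim_def prod_list_rGamma by (simp add: field_simps)
  show "weight_lim \<noteq> 0"
    unfolding weight_lim_def using c_nonint d_nonint one_minus_notin_Ints
    by (auto intro!: prod_list_rGamma_nonzero[of "map _ _", simplified])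
qed

text \<open>Of the two factors \<open>1 / rGamma (d ! j)\<close>, one cancels against
  \<open>pochhammer (d ! j - of_nat m) m\<close>, leaving
  \<open>Gamma (d ! j - of_nat m)\<close>.\<close>

lemma dweight_lim_eq:
  assumes j: "j < length d"
  shows "dweight_lim j = Gamma (d ! j - of_nat m) * Gamma (d ! j) * Gamma_vec (map (\<lambda>x. d ! j - x) (remove_nth j d))
     / ((d ! j - of_nat m - 1) * (d ! j - 1) * Gamma_vec (map (\<lambda>x. d ! j - x) c))"
proof -
  let ?\<delta> = "d ! j"
  have "?\<delta> - of_nat m \<notin> \<int>"
    using d_nth_nonint[OF j] by (metis Ints_add Ints_of_nat diff_add_cancel)
  then have nonpos: "?\<delta> - of_nat m \<notin> \<int>\<^sub>\<le>\<^sub>0" "?\<delta> \<notin> \<int>\<^sub>\<le>\<^sub>0"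
    using d_nth_nonint[OF j] nonpos_Ints_subset_Ints by blast+
  then have G: "Gamma (?\<delta> - of_nat m) \<noteq> 0" "Gamma ?\<delta> \<noteq> 0"
    by (auto simp: Gamma_eq_zero_iff)
  have cancel: "inverse A / (inverse B * (x * inverse G) * (y * (G / H) * inverse G)) = H * G * B / (y * x * A)"
    if "H \<noteq> 0" "G \<noteq> 0" for A B G H x y :: complex
    using that by (simp add: field_simps)
  have "pochhammer (?\<delta> - of_nat m) m = Gamma ?\<delta> / Gamma (?\<delta> - of_nat m)"
    using pochhammer_Gamma[OF nonpos(1), of m] by simp
  moreover have "?\<delta> - 1 - of_nat m + 1 = ?\<delta> - of_nat m" by simp
  ultimately have "pochhammer (?\<delta> - 1 - of_nat m) (Suc m) = (?\<delta> - of_nat m - 1) * (Gamma ?\<delta> / Gamma (?\<delta> - of_nat m))"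
    by (simp add: pochhammer_rec algebra_simps)
  then show ?thesis
    unfolding dweight_lim_def prod_list_rGamma rGamma_inverse_Gamma by (simp only: cancel[OF G])
qed

lemma ncoef_eq:
  "ncoef j = prod_list (map (\<lambda>x. 1 - x) d) / prod_list (map (\<lambda>x. 1 - x) c) *
    ((-1) ^ j * poch_vec (map (\<lambda>x. 2 - x) d) j * fact j / (poch_vec (map (\<lambda>x. 2 - x) c) j * fact (m - 1 - j)))"
proof -
  have "poch_vec (map (\<lambda>x. 1 - x) xs) (Suc j) = prod_list (map (\<lambda>x. 1 - x) xs) * poch_vec (map (\<lambda>x. 2 - x) xs) j"
    for xs
    by (simp add: poch_vec_map pochhammer_rec prod_list_mult_distrib)
  then show ?thesis by (simp add: ncoef_def mult_ac)
qed

lemma suminf_coef: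
  "suminf coef = hypergeom c ((1 + of_nat m) # d) 1 / fact m"
  if "summable coef"
proof -
  have "fact (m + k) = (fact m * pochhammer (1 + of_nat m) k :: complex)" for k
    using pochhammer_product'[of "1 :: complex" m k] by (simp add: pochhammer_fact[symmetric])
  then have "poch_vec c k / poch_vec ((1 + of_nat m) # d) k * 1 ^ k / fact k = fact m * coef k" for k
    by (simp add: coef_def poch_vec_Cons)
  then show ?thesis
    unfolding hypergeom_def using suminf_mult[OF that, of "fact m"] by simp
qed

text \<open>Solves \<open>limit_identity\<close> for the \<open>brace\<close> part, after division
  by the nonzero \<open>weight_lim\<close>.\<close>

lemma digamma_series:
  assumes re: "Re exponent > 0"
  shows "(\<lambda>k. coef k * brace k) sums
    (cot_diff / fact m * hypergeom c ((1 + of_nat m) # d) 1 + (\<Sum>j<m. ncoef j)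
      - Gamma_vec (map (\<lambda>x. 1 - x) c) / Gamma_vec (map (\<lambda>x. 1 - x) d) *
        (\<Sum>j<length d. (-1) ^ m * dweight_lim j *
          hypergeom (map (\<lambda>x. 1 + x - d ! j) c)
            ([2 - d ! j, 2 - d ! j + of_nat m] @ map (\<lambda>x. 1 + x - d ! j) (remove_nth j d)) 1))"
proof -
  obtain L where L: "has_growth coef (- 1 - exponent) L" using has_growth_coef by blast
  have sc: "summable coef"
    by (rule summable_norm_cancel, rule has_growth_summable[OF L]) (use re in simp)
  have "has_growth (\<lambda>k. cot_diff - brace k) 0 (cot_diff - 0)"
    unfolding has_growth_tendsto_0 by (intro tendsto_diff tendsto_const brace_tendsto_0)
  note growth = has_growth_mult[OF L this]
  have sb: "summable (\<lambda>k. coef k * (cot_diff - brace k))"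
    by (rule summable_norm_cancel, rule has_growth_summable[OF growth]) (use re in simp)
  let ?S = "\<Sum>k. coef k * (cot_diff - brace k)"
  \<comment> \<open>Convergence of the digamma series follows from that of these two series, each
    summable by its growth rate.\<close>
  have "(\<lambda>k. cot_diff * coef k - coef k * (cot_diff - brace k)) sums (cot_diff * suminf coef - ?S)"
    by (intro sums_diff sums_mult summable_sums sc sb)
  then have "(\<lambda>k. coef k * brace k) sums (cot_diff * suminf coef - ?S)"
    by (simp add: algebra_simps)
  moreover have "?S = inverse weight_lim * (\<Sum>j<length d. (-1) ^ m * dweight_lim j * suminf (dcoef j)) - (\<Sum>j<m. ncoef j)"
  proof -
    have cancel: "x = inverse w * z - y" if "w * x + w * y = z" "w \<noteq> 0" for w x y z :: complex
      using that by (auto simp: field_simps)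
    show ?thesis
      by (rule cancel[OF _ weight_lim_eq(2)])
        (simp only: limit_identity[OF re], simp only: sum_distrib_left mult.assoc)
  qed
  moreover have "suminf (dcoef j) = hypergeom (map (\<lambda>x. 1 + x - d ! j) c)
      ([2 - d ! j, 2 - d ! j + of_nat m] @ map (\<lambda>x. 1 + x - d ! j) (remove_nth j d)) 1" for j
    by (simp add: hypergeom_def dcoef_def[abs_def])
  ultimately show ?thesis
    by (simp add: suminf_coef[OF sc] weight_lim_eq(1) diff_diff_eq2)
qed

end

theorem mainTheorem1:
  fixes p m :: nat and c d :: "complex list"
  assumes hp: "p \<ge> 1"
    and hc_len: "length c = p + 1"
    and hd_len: "length d = p - 1"
    and hc: "\<forall>x\<in>set c. x \<notin> \<int>"
    and hd: "\<forall>x\<in>set d. x \<notin> \<int>"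
    and hdd: "\<forall>j<length d. \<forall>k<length d. j \<noteq> k \<longrightarrow> d ! j - d ! k \<notin> \<int>"
    and hre: "Re (sum_list d - sum_list c) > - real m - 1"
  shows "(\<lambda>k. poch_vec c k / (poch_vec d k * fact (m + k) * fact k) *
              (sum_list (map (\<lambda>x. Digamma (x + of_nat k)) d) + Digamma (of_nat k + 1)
               + Digamma (1 + of_nat m + of_nat k) - sum_list (map (\<lambda>x. Digamma (x + of_nat k)) c)))
    sums
      (complex_of_real pi / fact m
         * (sum_list (map (\<lambda>x. cot (complex_of_real pi * x)) c)
            - sum_list (map (\<lambda>x. cot (complex_of_real pi * x)) d))
         * hypergeom c ((1 + of_nat m) # d) 1
       + prod_list (map (\<lambda>x. 1 - x) d) / prod_list (map (\<lambda>x. 1 - x) c)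
         * (\<Sum>j<m. (-1) ^ j * poch_vec (map (\<lambda>x. 2 - x) d) j * fact j
                     / (poch_vec (map (\<lambda>x. 2 - x) c) j * fact (m - 1 - j)))
       - Gamma_vec (map (\<lambda>x. 1 - x) c) / Gamma_vec (map (\<lambda>x. 1 - x) d)
         * (\<Sum>k<length d.
              (-1) ^ m * Gamma (d ! k - of_nat m) * Gamma (d ! k)
                * Gamma_vec (map (\<lambda>x. d ! k - x) (remove_nth k d))
              / ((d ! k - of_nat m - 1) * (d ! k - 1) * Gamma_vec (map (\<lambda>x. d ! k - x) c))
              * hypergeom (map (\<lambda>x. 1 + x - d ! k) c)
                  ([2 - d ! k, 2 - d ! k + of_nat m] @ map (\<lambda>x. 1 + x - d ! k) (remove_nth k d)) 1))"
proof -
  interpret hypergeometric_parameters c d m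
    \<comment> \<open>With \<open>p \<ge> 1\<close> the natural number subtraction
      \<open>p - 1\<close> is exact, so \<open>length c = length d + 2\<close>.\<close>
    by standard (use hp hc_len hd_len hc hd hdd in auto)
  have "Re exponent > 0" using hre by (simp add: exponent_def)
  from digamma_series[OF this] show ?thesis
    unfolding coef_def brace_def
    by (rule back_subst[of "(sums) _"])
      (simp add: cot_diff_def ncoef_eq sum_distrib_left dweight_lim_eq mult.assoc)
qed

end
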